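(* Let $\gamma\ge1$. Consider SMC-ID on instances with conflict graph $G$ whose job parameters satisfy $0<\overrightarrow{b}\le\overleftarrow{b}\le p$, and suppose that a $\frac1\gamma$-approximate $\left(\lceil p/\overleftarrow{b}\rceil+1\right)$-IS of $G$ is given. Then SMC-ID allows for a $2\gamma\left(1+\left\lfloor \frac{p}{\overleftarrow{b}}\right\rfloor\cdot\frac{\overleftarrow{b}}{q}\right)$-approximation, where $q=\overleftarrow{b}+p+\overrightarrow{b}$, and moreover $2\gamma\left(1+\left\lfloor \frac{p}{\overleftarrow{b}}\right\rfloor\cdot\frac{\overleftarrow{b}}{q}\right)<4\gamma$.
   Context: SMC-ID is the following problem (scheduling with machine conflicts, identical jobs). An instance consists of a finite simple conflict graph $G=(V,E)$ whose vertices are the $m=|V|$ machines, and $n$ identical jobs, each with parameters $(\overleftarrow{b},p,\overrightarrow{b})$: first blocking time, processing time, second blocking time; the system time is $q=\overleftarrow{b}+p+\overrightarrow{b}$. A (conflict-free) schedule $\Pi$ assigns to each job $j$ a machine and a starting time $S_j^\Pi\ge 0$; $C_j^\Pi=S_j^\Pi+q$ is its completion time and $j$ occupies its machine, without preemption, during $(S_j^\Pi,C_j^\Pi)$; its blocking intervals are $[S_j^\Pi,S_j^\Pi+\overleftarrow{b}]$ and $[C_j^\Pi-\overrightarrow{b},C_j^\Pi]$. Requirements: each machine executes at most one job at any time, and for any two jobs on machines $i,i'$ with $\{i,i'\}\in E$, no blocking interval of one overlaps interiorly with a blocking interval of the other. The makespan is $\|\Pi\|=\max_j C_j^\Pi$,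 to be minimized. For an integer $c\ge 1$, a $c$-IS of $G$ is a collection of $c$ pairwise disjoint independent sets $I_1,\dots,I_c\subseteq V$ of $G$; its size is $|I_1\cup\dots\cup I_c|$. $\alpha_c(G)$ denotes the maximum size of a $c$-IS, and a $c$-IS is $\frac1\gamma$-approximate if its size is at least $\alpha_c(G)/\gamma$. An $r$-approximation is a polynomial-time algorithm that outputs a conflict-free schedule of makespan at most $r$ times the minimum makespan. *)

theory Defs
  imports "HOL-Analysis.Analysis" "HOL-Library.Log_Nat"
begin

section \<open>Independent sets\<close>

definition simple_graph :: "'a set \<Rightarrow> 'a set set \<Rightarrow> bool" where
  "simple_graph V E \<longleftrightarrow> finite V \<and> (\<forall>e\<in>E. \<exists>u v. e = {u, v} \<and> u \<in> V \<and> v \<in> V \<and> u \<noteq> v)"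

definition independent_set :: "'a set \<Rightarrow> 'a set set \<Rightarrow> 'a set \<Rightarrow> bool" where
  "independent_set V E A \<longleftrightarrow> A \<subseteq> V \<and> (\<forall>u\<in>A. \<forall>v\<in>A. {u, v} \<notin> E)"

text \<open>A \<open>c\<close>-IS is a family indexed by \<open>{..<c}\<close>; members may be empty, so that \<open>c\<close> may exceed
  the number of vertices. The values of the family at indices \<open>\<ge> c\<close> are irrelevant.\<close>

definition c_IS :: "'a set \<Rightarrow> 'a set set \<Rightarrow> nat \<Rightarrow> (nat \<Rightarrow> 'a set) \<Rightarrow> bool" where
  "c_IS V E c J \<longleftrightarrow> (\<forall>i<c. independent_set V E (J i)) \<and> disjoint_family_on J {..<c}"

definition c_IS_size :: "nat \<Rightarrow> (nat \<Rightarrow> 'a set) \<Rightarrow> nat" where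
  "c_IS_size c J = card (\<Union>i<c. J i)"

definition alpha :: "nat \<Rightarrow> 'a set \<Rightarrow> 'a set set \<Rightarrow> nat" where
  "alpha c V E = Max {c_IS_size c J | J. c_IS V E c J}"

definition approx_c_IS :: "real \<Rightarrow> 'a set \<Rightarrow> 'a set set \<Rightarrow> nat \<Rightarrow> (nat \<Rightarrow> 'a set) \<Rightarrow> bool" where
  "approx_c_IS \<gamma> V E c J \<longleftrightarrow>
     c_IS V E c J \<and> real (c_IS_size c J) \<ge> real (alpha c V E) / \<gamma>"


section \<open>Scheduling with machine conflicts, identical jobs\<close>

record smc_instance =
  machines :: "nat set"
  conflicts :: "nat set set"
  njobs :: nat
  block1 :: real
  ptime :: real
  block2 :: real

definition smc_id :: "smc_instance \<Rightarrow> bool" where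
  "smc_id I \<longleftrightarrow> simple_graph (machines I) (conflicts I) \<and> machines I \<noteq> {} \<and> njobs I \<ge> 1
     \<and> block1 I \<ge> 0 \<and> ptime I \<ge> 0 \<and> block2 I \<ge> 0"

definition system_time :: "smc_instance \<Rightarrow> real" where
  "system_time I = block1 I + ptime I + block2 I"

text \<open>The jobs are \<open>0, \<dots>, njobs I - 1\<close>.\<close>

record schedule =
  machine_of :: "nat \<Rightarrow> nat"
  start :: "nat \<Rightarrow> real"

definition completion :: "smc_instance \<Rightarrow> schedule \<Rightarrow> nat \<Rightarrow> real" where
  "completion I \<sigma> j = start \<sigma> j + system_time I"

definition blocking_intervals :: "smc_instance \<Rightarrow> schedule \<Rightarrow> nat \<Rightarrow> real set set" where
  "blocking_intervals I \<sigma> j =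
     {{start \<sigma> j .. start \<sigma> j + block1 I}, {completion I \<sigma> j - block2 I .. completion I \<sigma> j}}"

definition conflict_free :: "smc_instance \<Rightarrow> schedule \<Rightarrow> bool" where
  "conflict_free I \<sigma> \<longleftrightarrow>
     (\<forall>j<njobs I. machine_of \<sigma> j \<in> machines I \<and> start \<sigma> j \<ge> 0) \<and>
     (\<forall>j<njobs I. \<forall>j'<njobs I. j \<noteq> j' \<and> machine_of \<sigma> j = machine_of \<sigma> j' \<longrightarrow>
        {start \<sigma> j <..< completion I \<sigma> j} \<inter> {start \<sigma> j' <..< completion I \<sigma> j'} = {}) \<and>
     (\<forall>j<njobs I. \<forall>j'<njobs I. {machine_of \<sigma> j, machine_of \<sigma> j'} \<in> conflicts I \<longrightarrow>
        (\<forall>B \<in> blocking_intervals I \<sigma> j. \<forall>B' \<in> blocking_intervals I \<sigma> j'.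
           interior B \<inter> interior B' = {}))"

definition makespan :: "smc_instance \<Rightarrow> schedule \<Rightarrow> real" where
  "makespan I \<sigma> = Max (completion I \<sigma> ` {..<njobs I})"

text \<open>The infimum is attained, since all constraints are closed.\<close>

definition opt_makespan :: "smc_instance \<Rightarrow> real" where
  "opt_makespan I = Inf {makespan I \<sigma> | \<sigma>. conflict_free I \<sigma>}"


section \<open>Polynomial-time algorithms\<close>

text \<open>
  Algorithms are programs of a first-order, call-by-value functional language whose data are
  binary trees with natural numbers (in binary) at the leaves. The cost is logarithmic: every
  step is charged the total bit size of the values it reads, stores or produces. In particular
  the values alive at any moment have total size bounded by the time used so far plus the
  input, and the arithmetic primitives are polynomial-time in the bit size, so that polynomial
  time here is polynomial time on Turing machines.
\<close>

datatype val = VNum nat | VNil | VCons val val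

text \<open>\<open>floorlog 2 n\<close> is the number of binary digits of \<open>n\<close>.\<close>

fun vsize :: "val \<Rightarrow> nat" where
  "vsize (VNum n) = 1 + floorlog 2 n"
| "vsize VNil = 1"
| "vsize (VCons v w) = 1 + vsize v + vsize w"

datatype binop = PCons | PAdd | PSub | PMul | PDiv | PLess | PEqual

datatype unop = PHead | PTail

fun apply_unop :: "unop \<Rightarrow> val \<Rightarrow> val" where
  "apply_unop PHead (VCons v w) = v"
| "apply_unop PTail (VCons v w) = w"
| "apply_unop _ _ = VNil"

text \<open>Subtraction and division are those of \<open>nat\<close>; ill-typed applications yield \<open>VNil\<close>.\<close>

fun apply_binop :: "binop \<Rightarrow> val \<Rightarrow> val \<Rightarrow> val" where
  "apply_binop PCons v w = VCons v w"
| "apply_binop PEqual v w = VNum (if v = w then 1 else 0)"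
| "apply_binop PAdd (VNum a) (VNum b) = VNum (a + b)"
| "apply_binop PSub (VNum a) (VNum b) = VNum (a - b)"
| "apply_binop PMul (VNum a) (VNum b) = VNum (a * b)"
| "apply_binop PDiv (VNum a) (VNum b) = VNum (a div b)"
| "apply_binop PLess (VNum a) (VNum b) = VNum (if a < b then 1 else 0)"
| "apply_binop _ _ _ = VNil"

text \<open>Variables are de Bruijn indices into the current environment: \<open>LetIn\<close> pushes one value,
  and a function body is evaluated in the environment consisting of its arguments only.
  A program is a list of function bodies, function \<open>0\<close> being the entry point.\<close>

datatype expr =
    Var nat
  | Num nat
  | Empty
  | Unary unop expr
  | Binary binop expr expr
  | Cond expr expr expr
  | LetIn expr expr
  | Call nat "expr list"

type_synonym program = "expr list"

text \<open>\<open>eval P env e v t\<close>: under \<open>env\<close>, \<open>e\<close> evaluates to \<open>v\<close> in time \<open>t\<close>. \<open>VNum 0\<close> is false,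
  every other value is true.\<close>

inductive eval :: "program \<Rightarrow> val list \<Rightarrow> expr \<Rightarrow> val \<Rightarrow> nat \<Rightarrow> bool"
  and evals :: "program \<Rightarrow> val list \<Rightarrow> expr list \<Rightarrow> val list \<Rightarrow> nat \<Rightarrow> bool"
  for P :: program
where
  eval_Var: "i < length env \<Longrightarrow> eval P env (Var i) (env ! i) (1 + vsize (env ! i))"
| eval_Num: "eval P env (Num n) (VNum n) (1 + vsize (VNum n))"
| eval_Empty: "eval P env Empty VNil (1 + vsize VNil)"
| eval_Unary: "eval P env e v t \<Longrightarrow>
    eval P env (Unary f e) (apply_unop f v) (1 + t + vsize v + vsize (apply_unop f v))"
| eval_Binary: "eval P env e v t \<Longrightarrow> eval P env e' v' t' \<Longrightarrow>
    eval P env (Binary f e e') (apply_binop f v v')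
      (1 + t + t' + vsize v + vsize v' + vsize (apply_binop f v v'))"
| eval_Cond_True: "eval P env e v t \<Longrightarrow> v \<noteq> VNum 0 \<Longrightarrow> eval P env e1 w t' \<Longrightarrow>
    eval P env (Cond e e1 e2) w (1 + t + vsize v + t')"
| eval_Cond_False: "eval P env e v t \<Longrightarrow> v = VNum 0 \<Longrightarrow> eval P env e2 w t' \<Longrightarrow>
    eval P env (Cond e e1 e2) w (1 + t + vsize v + t')"
| eval_LetIn: "eval P env e v t \<Longrightarrow> eval P (v # env) e' w t' \<Longrightarrow>
    eval P env (LetIn e e') w (1 + t + vsize v + t')"
| eval_Call: "evals P env es vs t \<Longrightarrow> f < length P \<Longrightarrow> eval P vs (P ! f) w t' \<Longrightarrow>
    eval P env (Call f es) w (1 + t + sum_list (map vsize vs) + t')"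
| evals_Nil: "evals P env [] [] 0"
| evals_Cons: "eval P env e v t \<Longrightarrow> evals P env es vs t' \<Longrightarrow>
    evals P env (e # es) (v # vs) (t + t')"

inductive_cases eval_elims:
  "eval P env (Var i) v t" "eval P env (Num n) v t" "eval P env Empty v t"
  "eval P env (Unary f e) v t" "eval P env (Binary f e e') v t" "eval P env (Cond e e1 e2) v t"
  "eval P env (LetIn e e') v t" "eval P env (Call f es) v t"

inductive_cases evals_elims:
  "evals P env [] vs t" "evals P env (e # es) vs t"

lemma eval_deterministic:
  "eval P env e v t \<Longrightarrow> (\<forall>v' t'. eval P env e v' t' \<longrightarrow> v' = v \<and> t' = t)"
  "evals P env es vs s \<Longrightarrow> (\<forall>vs' s'. evals P env es vs' s' \<longrightarrow> vs' = vs \<and> s' = s)"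
proof (induction rule: eval_evals.inducts)
  case (eval_Var i env) then show ?case by (auto elim: eval_elims)
next
  case (eval_Num env n) then show ?case by (auto elim: eval_elims)
next
  case (eval_Empty env) then show ?case by (auto elim: eval_elims)
next
  case (eval_Unary env e v t f) then show ?case by - (unfold plus_1_eq_Suc add_Suc, intro allI impI, erule eval_elims(4), metis)
next
  case (eval_Binary env e v t e' v' t' f) then show ?case by - (unfold plus_1_eq_Suc add_Suc, intro allI impI, erule eval_elims(5), metis)
next
  case (eval_Cond_True env e v t e1 w t' e2) then show ?case by - (unfold plus_1_eq_Suc add_Suc, intro allI impI, erule eval_elims(6), metis+)
next
  case (eval_Cond_False env e v t e2 w t' e1) then show ?case by - (unfold plus_1_eq_Suc add_Suc, intro allI impI, erule eval_elims(6), metis,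
       metis vsize.simps(1) plus_1_eq_Suc add_Suc add_Suc_right)
next
  case (eval_LetIn env e v t e' w t') then show ?case by - (unfold plus_1_eq_Suc add_Suc, intro allI impI, erule eval_elims(7), metis)
next
  case (eval_Call env es vs t f w t') then show ?case by - (unfold plus_1_eq_Suc add_Suc, intro allI impI, erule eval_elims(8), metis)
next
  case (evals_Nil env) then show ?case by (auto elim: evals_elims)
next
  case (evals_Cons env e v t es vs t') then show ?case by - (intro allI impI, erule evals_elims(2), metis)
qed

definition runs :: "program \<Rightarrow> val \<Rightarrow> val \<Rightarrow> nat \<Rightarrow> bool" where
  "runs P x y t \<longleftrightarrow> eval P [x] (Call 0 [Var 0]) y t"


section \<open>Encodings\<close>

definition vlist :: "val list \<Rightarrow> val" where
  "vlist vs = foldr VCons vs VNil"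

text \<open>Numerical data are nonnegative rationals, written as arbitrary (not necessarily reduced)
  fractions; a real number without such a representation is not an admissible input.\<close>

definition represents_real :: "val \<Rightarrow> real \<Rightarrow> bool" where
  "represents_real x r \<longleftrightarrow> (\<exists>a d. d > 0 \<and> x = VCons (VNum a) (VNum d) \<and> r = real a / real d)"

definition represents_set :: "val \<Rightarrow> nat set \<Rightarrow> bool" where
  "represents_set x A \<longleftrightarrow> (\<exists>xs. distinct xs \<and> set xs = A \<and> x = vlist (map VNum xs))"

definition represents_edges :: "val \<Rightarrow> nat set set \<Rightarrow> bool" where
  "represents_edges x E \<longleftrightarrow> (\<exists>es. (\<lambda>(u, v). {u, v}) ` set es = E \<and>
     x = vlist (map (\<lambda>(u, v). VCons (VNum u) (VNum v)) es))"

text \<open>The jobs are listed one by one (the number of jobs is in unary), as the schedule to be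
  produced specifies a machine and a starting time for every job.\<close>

definition represents_instance :: "val \<Rightarrow> smc_instance \<Rightarrow> bool" where
  "represents_instance x I \<longleftrightarrow> (\<exists>xV xE x1 xp x2.
     represents_set xV (machines I) \<and> represents_edges xE (conflicts I) \<and>
     represents_real x1 (block1 I) \<and> represents_real xp (ptime I) \<and>
     represents_real x2 (block2 I) \<and>
     x = vlist [xV, xE, vlist (replicate (njobs I) VNil), x1, xp, x2])"

text \<open>Trailing empty members of a \<open>c\<close>-IS may be omitted from the list (\<open>c\<close> can be exponential in
  the size of the instance); the running time is polynomial in the list as given.\<close>

definition represents_c_IS :: "val \<Rightarrow> nat \<Rightarrow> (nat \<Rightarrow> nat set) \<Rightarrow> bool" where
  "represents_c_IS x c J \<longleftrightarrow> (\<exists>xs. length xs \<le> c \<and> x = vlist xs \<and>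
     (\<forall>i<length xs. represents_set (xs ! i) (J i)) \<and> (\<forall>i. length xs \<le> i \<and> i < c \<longrightarrow> J i = {}))"

definition represents_schedule :: "val \<Rightarrow> smc_instance \<Rightarrow> schedule \<Rightarrow> bool" where
  "represents_schedule y I \<sigma> \<longleftrightarrow> (\<exists>ys. length ys = njobs I \<and> y = vlist ys \<and>
     (\<forall>j<njobs I. \<exists>r. ys ! j = VCons (VNum (machine_of \<sigma> j)) r \<and> represents_real r (start \<sigma> j)))"


section \<open>Approximation algorithms\<close>

text \<open>\<open>is_input x I\<close>: \<open>x\<close> is an admissible input for the instance \<open>I\<close>; it may contain more
  than the instance itself. The approximation ratio \<open>\<rho>\<close> may depend on the instance.
  As \<open>vsize x \<ge> 1\<close>, the bounds \<open>k * vsize x ^ k\<close> are cofinal among the polynomial ones.\<close>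

definition approximation_algorithm ::
  "program \<Rightarrow> (val \<Rightarrow> smc_instance \<Rightarrow> bool) \<Rightarrow> (smc_instance \<Rightarrow> real) \<Rightarrow> bool" where
  "approximation_algorithm P is_input \<rho> \<longleftrightarrow>
     (\<exists>k. \<forall>x I. is_input x I \<longrightarrow>
        (\<exists>y t \<sigma>. runs P x y t \<and> t \<le> k * vsize x ^ k \<and>
           represents_schedule y I \<sigma> \<and> conflict_free I \<sigma> \<and>
           makespan I \<sigma> \<le> \<rho> I * opt_makespan I))"

definition allows_approximation ::
  "(val \<Rightarrow> smc_instance \<Rightarrow> bool) \<Rightarrow> (smc_instance \<Rightarrow> real) \<Rightarrow> bool" where
  "allows_approximation is_input \<rho> \<longleftrightarrow> (\<exists>P. approximation_algorithm P is_input \<rho>)"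


section \<open>Instances given together with an approximate \<open>c\<close>-IS\<close>

definition ordered_times :: "smc_instance \<Rightarrow> bool" where
  "ordered_times I \<longleftrightarrow> 0 < block2 I \<and> block2 I \<le> block1 I \<and> block1 I \<le> ptime I"

definition num_sets :: "smc_instance \<Rightarrow> nat" where
  "num_sets I = nat \<lceil>ptime I / block1 I\<rceil> + 1"

definition input_with_c_IS :: "real \<Rightarrow> val \<Rightarrow> smc_instance \<Rightarrow> bool" where
  "input_with_c_IS \<gamma> x I \<longleftrightarrow> smc_id I \<and> ordered_times I \<and>
     (\<exists>xI xJ J. x = VCons xI xJ \<and> represents_instance xI I \<and>
        represents_c_IS xJ (num_sets I) J \<and>
        approx_c_IS \<gamma> (machines I) (conflicts I) (num_sets I) J)"

end

(*
Write f = floor (p/b), where b is the first blocking time. A window of length q contains the starts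
of at most alpha_c jobs, where c = ceil (p/b) + 1: these jobs run on distinct machines, and two of
them on adjacent machines start between b and p apart. So the jobs starting in the first b or in the
last b' time units of the window (b' <= b being the second blocking time) use one independent set of
machines, and the p time units in between split into ceil (p/b) parts of length at most b, each of
which contributes another independent set. Hence n <= alpha_c * floor (OPT/q).

Conversely, f + 1 independent sets can be served in a round of length q + f b, the i-th one starting
at offset i b. If c = f + 2 sets are given, the smallest one is dropped, and at least (f+1)/(f+2) of
the machines remain. Comparing the number of rounds with the lower bound proves the ratio, except
that rounding up can spoil it when f = 1, gamma < 3/2, three rounds are needed and OPT < 9/8 q.
Then q < 4 b, so all jobs of the optimal schedule start within time b and their machines form an
independent set H with n elements. Exchanging H against any one of the three given sets shows that
H contains most of their union T. Therefore removing a greedy maximal matching from the graph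
induced on T leaves an independent set with at least n/3 elements, on which all jobs are served in
three rounds of length q.
*)
theory Submission
  imports Defs
begin

section \<open>Evaluation with bounded values\<close>

text \<open>The program knows neither \<gamma> nor the optimum, so it cannot test for the
  exceptional case. Instead it compares counts: the three fallback rounds are used whenever they
  hold all \<open>n\<close> jobs while two main rounds do not. This is safe, because a main plan of
  at least three rounds, each at least \<open>q\<close> long, is never shorter than three rounds of
  length \<open>q\<close>. Thus only one implication has to be proved: if the main plan misses the
  ratio, then the fallback is large enough.

  The set H comes from a schedule that the program never sees. The matching is nevertheless good for
  it: every edge has an end outside H, so each matched pair uses up a vertex of T - H, and at most 2
  |T - H| vertices are lost, whatever H is.

  Three rounds of length \<open>q\<close> are affordable in the exceptional case: there \<gamma> >
  4/3, and \<open>q\<close> < 4 \<open>b\<close> makes a main round at least 5/4 \<open>q\<close>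
  long, so the allowed makespan is at least 2 * 4/3 * 5/4 \<open>q\<close> = 10/3
  \<open>q\<close>.\<close>

text \<open>All values have size at most \<open>M\<close>, so that the running time is at most \<open>M\<close> times a number \<open>k\<close>
  of steps that no longer depends on sizes.\<close>

definition ev :: "nat \<Rightarrow> program \<Rightarrow> val list \<Rightarrow> expr \<Rightarrow> val \<Rightarrow> nat \<Rightarrow> bool" where
  "ev M P env e v k \<longleftrightarrow> (\<exists>t. eval P env e v t \<and> t \<le> k * M) \<and> vsize v \<le> M"

definition evs :: "nat \<Rightarrow> program \<Rightarrow> val list \<Rightarrow> expr list \<Rightarrow> val list \<Rightarrow> nat \<Rightarrow> bool" where
  "evs M P env es vs k \<longleftrightarrow> (\<exists>t. evals P env es vs t \<and> t \<le> k * M) \<and> (\<forall>v\<in>set vs. vsize v \<le> M)"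

lemma vsize_pos: "1 \<le> vsize v"
  by (cases v) auto

lemma vsize_unop: "vsize (apply_unop f v) \<le> vsize v"
  by (cases f; cases v) auto

lemma ev_le: "ev M P env e v k \<Longrightarrow> k \<le> k' \<Longrightarrow> ev M P env e v k'"
  unfolding ev_def by (meson le_trans mult_le_mono1)

text \<open>Starts a symbolic execution: value and step count become schematic, the evaluation rules
  fill them in, and the comparison with the claimed value and bound comes last.\<close>

lemma ev_eq: "ev M P env e v k \<Longrightarrow> v = v' \<Longrightarrow> k \<le> k' \<Longrightarrow> ev M P env e v' k'"
  using ev_le by blast

lemma ev_Var: "i < length env \<Longrightarrow> vsize (env ! i) \<le> M \<Longrightarrow> ev M P env (Var i) (env ! i) 2"
  unfolding ev_def using eval_Var[of i env P] vsize_pos[of "env ! i"]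
  by (auto intro!: exI[of _ "Suc (vsize (env ! i))"])

lemma ev_Num: "vsize (VNum n) \<le> M \<Longrightarrow> ev M P env (Num n) (VNum n) 2"
  unfolding ev_def using eval_Num[of P env n] vsize_pos[of "VNum n"]
  by (intro conjI exI[of _ "1 + vsize (VNum n)"]) auto

lemma ev_Empty: "1 \<le> M \<Longrightarrow> ev M P env Empty VNil 2"
  unfolding ev_def using eval_Empty[of P env]
  by (intro conjI exI[of _ "1 + vsize VNil"]) auto

lemma ev_Unary:
  assumes "ev M P env e v k"
  shows "ev M P env (Unary f e) (apply_unop f v) (k + 3)"
proof -
  obtain t where t: "eval P env e v t" "t \<le> k * M" "vsize v \<le> M"
    using assms by (auto simp: ev_def)
  show ?thesis
    unfolding ev_def
    using eval_Unary[OF t(1), of f] t(2,3) vsize_unop[of f v] vsize_pos[of v]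
    by (intro conjI exI[of _ "1 + t + vsize v + vsize (apply_unop f v)"])
      (auto simp: algebra_simps)
qed

lemma ev_Binary:
  assumes "ev M P env e v k" "ev M P env e' v' k'" "vsize (apply_binop f v v') \<le> M"
  shows "ev M P env (Binary f e e') (apply_binop f v v') (k + k' + 4)"
proof -
  obtain t t' where t: "eval P env e v t" "t \<le> k * M" "vsize v \<le> M"
    and t': "eval P env e' v' t'" "t' \<le> k' * M" "vsize v' \<le> M"
    using assms by (auto simp: ev_def)
  show ?thesis
    unfolding ev_def
    using eval_Binary[OF t(1) t'(1), of f] t(2,3) t'(2,3) assms(3) vsize_pos[of v]
    by (intro conjI exI[of _ "1 + t + t' + vsize v + vsize v' + vsize (apply_binop f v v')"])
      (auto simp: algebra_simps)
qed

lemma ev_Cond: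
  assumes "ev M P env e v k"
    and "v \<noteq> VNum 0 \<Longrightarrow> ev M P env e1 w k'" and "v = VNum 0 \<Longrightarrow> ev M P env e2 w k'"
  shows "ev M P env (Cond e e1 e2) w (k + k' + 2)"
proof -
  obtain t where t: "eval P env e v t" "t \<le> k * M" "vsize v \<le> M"
    using assms by (auto simp: ev_def)
  obtain t' where t': "eval P env (if v = VNum 0 then e2 else e1) w t'" "t' \<le> k' * M" "vsize w \<le> M"
    using assms(2,3) unfolding ev_def by (cases "v = VNum 0") auto
  have "eval P env (Cond e e1 e2) w (1 + t + vsize v + t')"
    using eval_Cond_True[OF t(1)] eval_Cond_False[OF t(1)] t'(1) by (auto split: if_splits)
  then show ?thesis
    unfolding ev_def using t(2,3) t'(2,3) vsize_pos[of v]
    by (intro conjI exI[of _ "1 + t + vsize v + t'"]) (auto simp: algebra_simps)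
qed

lemma ev_LetIn:
  assumes "ev M P env e v k" "ev M P (v # env) e' w k'"
  shows "ev M P env (LetIn e e') w (k + k' + 2)"
proof -
  obtain t t' where t: "eval P env e v t" "t \<le> k * M" "vsize v \<le> M"
    and t': "eval P (v # env) e' w t'" "t' \<le> k' * M" "vsize w \<le> M"
    using assms by (auto simp: ev_def)
  show ?thesis
    unfolding ev_def
    using eval_LetIn[OF t(1) t'(1)] t(2,3) t'(2,3) vsize_pos[of v]
    by (intro conjI exI[of _ "1 + t + vsize v + t'"]) (auto simp: algebra_simps)
qed

lemma evs_Nil: "evs M P env [] [] 0"
  unfolding evs_def using evals_Nil by auto

lemma evs_Cons:
  assumes "ev M P env e v k" "evs M P env es vs k'"
  shows "evs M P env (e # es) (v # vs) (k + k')"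
  using assms unfolding ev_def evs_def
  by (auto simp: algebra_simps intro: add_mono dest: evals_Cons)

lemma ev_Call:
  assumes "evs M P env es vs k" "f < length P" "ev M P vs (P ! f) w k'"
  shows "ev M P env (Call f es) w (k + length vs + 1 + k')"
proof -
  obtain t t' where t: "evals P env es vs t" "t \<le> k * M" "\<forall>v\<in>set vs. vsize v \<le> M"
    and t': "eval P vs (P ! f) w t'" "t' \<le> k' * M" "vsize w \<le> M"
    using assms by (auto simp: ev_def evs_def)
  have "sum_list (map vsize vs) \<le> length vs * M"
    using t(3) by (induction vs) auto
  moreover have "1 \<le> M"
    using t'(3) vsize_pos[of w] by linarith
  ultimately show ?thesis
    unfolding ev_def
    using eval_Call[OF t(1) assms(2) t'(1)] t(2,3) t'(2,3)
    by (intro conjI exI[of _ "1 + t + sum_list (map vsize vs) + t'"]) (auto simp: algebra_simps)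
qed

abbreviation hd_expr :: "expr \<Rightarrow> expr" where "hd_expr e \<equiv> Unary PHead e"
abbreviation tl_expr :: "expr \<Rightarrow> expr" where "tl_expr e \<equiv> Unary PTail e"
abbreviation cons_expr :: "expr \<Rightarrow> expr \<Rightarrow> expr" where "cons_expr \<equiv> Binary PCons"
abbreviation is_nil_expr :: "expr \<Rightarrow> expr" where "is_nil_expr e \<equiv> Binary PEqual e Empty"

section \<open>The program\<close>

text \<open>Function numbers are positions in \<open>prog\<close>.\<close>

abbreviation slots_call :: "expr \<Rightarrow> expr \<Rightarrow> expr" where
  "slots_call xss b \<equiv> Call 4 [xss, b]"
abbreviation slots_aux_call :: "expr \<Rightarrow> expr \<Rightarrow> expr \<Rightarrow> expr \<Rightarrow> expr" where
  "slots_aux_call ms xss off b \<equiv> Call 5 [ms, xss, off, b]"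
abbreviation drop_smallest_call :: "expr \<Rightarrow> expr \<Rightarrow> expr" where
  "drop_smallest_call xs xss \<equiv> Call 6 [xs, xss]"
abbreviation greedy_call :: "expr \<Rightarrow> expr \<Rightarrow> expr" where
  "greedy_call es l \<equiv> Call 7 [es, l]"
abbreviation remove_call :: "expr \<Rightarrow> expr \<Rightarrow> expr" where
  "remove_call u l \<equiv> Call 8 [u, l]"
abbreviation len_call :: "expr \<Rightarrow> expr" where
  "len_call l \<equiv> Call 9 [l]"
abbreviation assign_call :: "expr \<Rightarrow> expr \<Rightarrow> expr \<Rightarrow> expr \<Rightarrow> expr \<Rightarrow> expr \<Rightarrow> expr" where
  "assign_call jobs sl full base Q D \<equiv> Call 10 [jobs, sl, full, base, Q, D]"

definition len_body :: expr where
  "len_body = Cond (is_nil_expr (Var 0)) (Num 0)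
     (Binary PAdd (Num 1) (len_call (tl_expr (Var 0))))"

definition remove_body :: expr where
  "remove_body = Cond (is_nil_expr (Var 1)) Empty
     (Cond (Binary PEqual (hd_expr (hd_expr (Var 1))) (Var 0))
        (remove_call (Var 0) (tl_expr (Var 1)))
        (cons_expr (hd_expr (Var 1)) (remove_call (Var 0) (tl_expr (Var 1)))))"

text \<open>Inside \<open>LetIn\<close>, \<open>Var 0\<close> is the shortened list, while the edges
  and the old list have moved to \<open>Var 1\<close> and \<open>Var 2\<close>. Lengths replace a
  membership test: in a list with distinct machines, deleting two different ones removes two entries
  exactly if both were present.\<close>

definition greedy_body :: expr where
  "greedy_body = Cond (is_nil_expr (Var 0)) (Var 1)
     (LetIn
        (remove_call (hd_expr (hd_expr (Var 0))) (remove_call (tl_expr (hd_expr (Var 0))) (Var 1)))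
        (greedy_call (tl_expr (Var 1))
          (Cond (Binary PEqual (Binary PAdd (Num 2) (len_call (Var 0))) (len_call (Var 2)))
             (Var 0) (Var 2))))"

definition drop_smallest_body :: expr where
  "drop_smallest_body = Cond (is_nil_expr (Var 1)) Empty
     (Cond (Binary PLess (len_call (hd_expr (Var 1))) (len_call (Var 0)))
        (cons_expr (Var 0) (drop_smallest_call (hd_expr (Var 1)) (tl_expr (Var 1))))
        (cons_expr (hd_expr (Var 1)) (drop_smallest_call (Var 0) (tl_expr (Var 1)))))"

definition slots_aux_body :: expr where
  "slots_aux_body = Cond (is_nil_expr (Var 0))
     (Cond (is_nil_expr (Var 1)) Empty
        (slots_aux_call (hd_expr (Var 1)) (tl_expr (Var 1)) (Binary PAdd (Var 2) (Var 3)) (Var 3)))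
     (cons_expr (cons_expr (hd_expr (Var 0)) (Var 2))
        (slots_aux_call (tl_expr (Var 0)) (Var 1) (Var 2) (Var 3)))"

text \<open>The empty family is covered as well, since \<open>PHead\<close> and \<open>PTail\<close>
  return \<open>VNil\<close> on \<open>VNil\<close>.\<close>

definition slots_body :: expr where
  "slots_body = slots_aux_call (hd_expr (Var 0)) (tl_expr (Var 0)) (Num 0) (Var 1)"

text \<open>When the remaining slots run out, the full list is reloaded and the base time advances
  by one round. This branch consumes no job, so termination rests on \<open>full\<close> being
  nonempty.\<close>

definition assign_body :: expr where
  "assign_body = Cond (is_nil_expr (Var 0)) Empty
     (Cond (is_nil_expr (Var 1))
        (assign_call (Var 0) (Var 2) (Var 2) (Binary PAdd (Var 3) (Var 4)) (Var 4) (Var 5))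
        (cons_expr (cons_expr (hd_expr (hd_expr (Var 1)))
            (cons_expr (Binary PAdd (Var 3) (tl_expr (hd_expr (Var 1)))) (Var 5)))
          (assign_call (tl_expr (Var 0)) (tl_expr (Var 1)) (Var 2) (Var 3) (Var 4) (Var 5))))"

text \<open>Arguments: the jobs, the slots of a round, the slots of a round of the fallback, \<open>q\<close>, the length
  of a round, the common denominator of all times.\<close>

definition choose_body :: expr where
  "choose_body = Cond (Binary PLess (Binary PMul (Num 2) (len_call (Var 1))) (len_call (Var 0)))
     (Cond (Binary PLess (Binary PMul (Num 3) (len_call (Var 2))) (len_call (Var 0)))
       (assign_call (Var 0) (Var 1) (Var 1) (Num 0) (Var 4) (Var 5))
       (assign_call (Var 0) (Var 2) (Var 2) (Num 0) (Var 3) (Var 5)))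
     (assign_call (Var 0) (Var 1) (Var 1) (Num 0) (Var 4) (Var 5))"

text \<open>Arguments: the edges, the jobs, the independent sets, the common denominator \<open>D\<close>, and \<open>b\<close>, \<open>p\<close>, \<open>q\<close>
  in units of \<open>1 / D\<close>.\<close>

definition slots_choice_body :: expr where
  "slots_choice_body = Call 3 [Var 1,
     slots_call
       (Cond (Binary PLess (Binary PAdd (Num 1) (Binary PDiv (Var 5) (Var 4))) (len_call (Var 2)))
          (drop_smallest_call (hd_expr (Var 2)) (tl_expr (Var 2))) (Var 2))
       (Var 4),
     greedy_call (Var 0) (slots_call (Var 2) (Num 0)),
     Var 6,
     Binary PAdd (Var 6) (Binary PMul (Binary PDiv (Var 5) (Var 4)) (Var 4)),
     Var 3]"

text \<open>Clears denominators with their plain product; the numbers stay linear in bit length.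
  From here on all times are naturals, and natural division yields the floor of \<open>p / b\<close>
  exactly.\<close>

definition scale_body :: expr where
  "scale_body =
     (let num = (\<lambda>i. hd_expr (Var i)); den = (\<lambda>i. tl_expr (Var i));
          mul = Binary PMul; add = Binary PAdd;
          B1 = mul (num 3) (mul (den 4) (den 5));
          P = mul (num 4) (mul (den 3) (den 5));
          B2 = mul (num 5) (mul (den 3) (den 4))
      in Call 2 [Var 0, Var 1, Var 2, mul (den 3) (mul (den 4) (den 5)), B1, P, add B1 (add P B2)])"

definition unpack_body :: expr where
  "unpack_body =
     (let I = (\<lambda>i. hd_expr ((tl_expr ^^ i) (hd_expr (Var 0))))
      in Call 1 [I 1, I 2, tl_expr (Var 0), I 3, I 4, I 5])"

definition prog :: program where
  "prog = [unpack_body, scale_body, slots_choice_body, choose_body, slots_body, slots_aux_body,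
     drop_smallest_body, greedy_body, remove_body, len_body, assign_body]"

lemma prog_nth [simp]:
  "length prog = 11"
  "prog ! 0 = unpack_body" "prog ! Suc 0 = scale_body" "prog ! 2 = slots_choice_body"
  "prog ! 3 = choose_body" "prog ! 4 = slots_body" "prog ! 5 = slots_aux_body"
  "prog ! 6 = drop_smallest_body" "prog ! 7 = greedy_body" "prog ! 8 = remove_body"
  "prog ! 9 = len_body" "prog ! 10 = assign_body"
  by (simp_all add: prog_def)

section \<open>Rules for symbolic execution and encodings of lists\<close>

lemma vlist_simps [simp]: "vlist [] = VNil" "vlist (v # vs) = VCons v (vlist vs)"
  by (simp_all add: vlist_def)

lemma vsize_num_mono: "a \<le> b \<Longrightarrow> vsize (VNum a) \<le> vsize (VNum b)"
  by (simp add: floorlog_mono)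

lemma vsize_num_le: "vsize (VNum n) \<le> Suc w" if "n < 2 ^ w"
  using that by (simp add: floorlog_leI)

lemma ev_VarI:
  "i < length env \<Longrightarrow> env ! i = v \<Longrightarrow> vsize v \<le> M \<Longrightarrow> ev M P env (Var i) v 2"
  using ev_Var by blast

lemma ev_UnaryI:
  "ev M P env e v k \<Longrightarrow> apply_unop f v = w \<Longrightarrow> ev M P env (Unary f e) w (k + 3)"
  using ev_Unary by blast

lemma ev_BinaryI:
  "ev M P env e v k \<Longrightarrow> ev M P env e' v' k' \<Longrightarrow> apply_binop f v v' = w \<Longrightarrow> vsize w \<le> M \<Longrightarrow>
    ev M P env (Binary f e e') w (k + k' + 4)"
  using ev_Binary by blast

text \<open>The branch \<open>e'\<close> is left schematic and is found by simplifying the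
  condition. Therefore the execution proofs split into cases before a body is run.\<close>

lemma ev_CondI:
  "ev M P env e v k \<Longrightarrow> (if v = VNum 0 then e2 else e1) = e' \<Longrightarrow> ev M P env e' w k' \<Longrightarrow>
    ev M P env (Cond e e1 e2) w (k + k' + 2)"
  using ev_Cond by (metis (full_types))

lemma ev_CallI:
  "evs M P env es vs k \<Longrightarrow> length vs = l \<Longrightarrow> f < length P \<Longrightarrow> P ! f = b \<Longrightarrow> ev M P vs b w k' \<Longrightarrow>
    ev M P env (Call f es) w (k + l + 1 + k')"
  using ev_Call by blast

lemmas ev_rules = ev_VarI ev_Num ev_Empty ev_UnaryI ev_BinaryI ev_LetIn ev_CondI
  evs_Cons evs_Nil ev_CallI

lemma floorlog_simps [simp]: "floorlog 2 0 = 0" "floorlog 2 (Suc 0) = 1" "floorlog 2 2 = 2" "floorlog 2 3 = 2"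
  by (simp_all add: floorlog_eq_zero_iff compute_floorlog)

definition vnats :: "nat list \<Rightarrow> val" where
  "vnats ms = vlist (map VNum ms)"

definition vpairs :: "(nat \<times> nat) list \<Rightarrow> val" where
  "vpairs l = vlist (map (\<lambda>(a, b). VCons (VNum a) (VNum b)) l)"

lemma vlist_enc_simps [simp]:
  "vnats [] = VNil" "vnats (m # ms) = VCons (VNum m) (vnats ms)"
  "vpairs [] = VNil" "vpairs ((a, b) # l) = VCons (VCons (VNum a) (VNum b)) (vpairs l)"
  by (simp_all add: vnats_def vpairs_def)

section \<open>Execution of the single functions\<close>

lemma vsize_length: "vsize (VNum (length vs)) \<le> vsize (vlist vs)"
proof (induction vs)
  case (Cons v vs)
  have "length (v # vs) < 2 ^ length (v # vs)" by (rule less_exp)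
  then have "vsize (VNum (length (v # vs))) \<le> Suc (length (v # vs))"
    by (rule vsize_num_le)
  moreover have "Suc (length ws) \<le> vsize (vlist ws)" for ws
    by (induction ws) auto
  ultimately show ?case using le_trans by blast
qed simp

text \<open>The pattern of all execution proofs: induct on the data, run the body by
  \<open>ev_rules\<close>, and let the induction hypothesis act as the rule for the recursive call.
  The numerical factors are generous allowances for one unfolding.\<close>

lemma ev_len:
  assumes "2 \<le> M" "vsize (vlist vs) \<le> M"
  shows "ev M prog [vlist vs] len_body (VNum (length vs)) (40 * Suc (length vs))"
  using assms(2)
proof (induction vs)
  case Nil
  show ?case
    unfolding len_body_def
    apply (rule ev_eq)
      apply (rule ev_rules | use assms(1) in \<open>simp; fail\<close>)+
    done
next
  case (Cons v vs)
  have s: "vsize (VNum (length (v # vs))) \<le> M"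
    using vsize_length[of "v # vs"] Cons.prems by (rule le_trans)
  show ?case
    unfolding len_body_def
    apply (rule ev_eq)
      apply (rule ev_rules Cons.IH | use assms(1) Cons.prems s in \<open>simp; fail\<close>)+
    done
qed


lemma ev_len_nats:
  "2 \<le> M \<Longrightarrow> vsize (vnats ms) \<le> M \<Longrightarrow>
    ev M prog [vnats ms] len_body (VNum (length ms)) (40 * Suc (length ms))"
  using ev_len[of M "map VNum ms"] by (simp add: vnats_def)

lemma ev_len_pairs:
  "2 \<le> M \<Longrightarrow> vsize (vpairs l) \<le> M \<Longrightarrow>
    ev M prog [vpairs l] len_body (VNum (length l)) (40 * Suc (length l))"
  using ev_len[of M "map (\<lambda>(a, b). VCons (VNum a) (VNum b)) l"] by (simp add: vpairs_def)

lemma vsize_pairs_filter: "vsize (vpairs (filter Q l)) \<le> vsize (vpairs l)"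
  by (induction l) auto

lemma ev_remove:
  assumes "2 \<le> M" "vsize (VNum u) \<le> M" "vsize (vpairs l) \<le> M"
  shows "ev M prog [VNum u, vpairs l] remove_body (vpairs (filter (\<lambda>s. fst s \<noteq> u) l))
    (100 * Suc (length l))"
  using assms(3)
proof (induction l)
  case Nil
  show ?case
    unfolding remove_body_def
    apply (rule ev_eq)
      apply (rule ev_rules | use assms(1,2) in \<open>simp; fail\<close>)+
    done
next
  case (Cons s l)
  obtain a b where [simp]: "s = (a, b)" by (cases s)
  have f: "vsize (vpairs (filter (\<lambda>s. fst s \<noteq> u) l)) \<le> vsize (vpairs l)"
    by (rule vsize_pairs_filter)
  show ?case
  proof (cases "a = u")
    case True
    show ?thesis
      unfolding remove_body_def
      apply (rule ev_eq)
        apply (rule ev_rules Cons.IH | use assms(1,2) Cons.prems True f in \<open>simp; fail\<close>)+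
      done
  next
    case False
    show ?thesis
      unfolding remove_body_def
      apply (rule ev_eq)
        apply (rule ev_rules Cons.IH | use assms(1,2) Cons.prems False f in \<open>simp; fail\<close>)+
      done
  qed
qed

text \<open>Deletes both ends of an edge if both are still present, that is, the vertices of a greedily built
  maximal matching.\<close>

fun greedy :: "(nat \<times> nat) list \<Rightarrow> (nat \<times> nat) list \<Rightarrow> (nat \<times> nat) list" where
  "greedy [] l = l"
| "greedy ((u, v) # es) l =
    (let l' = filter (\<lambda>s. fst s \<noteq> u) (filter (\<lambda>s. fst s \<noteq> v) l)
     in greedy es (if length l' + 2 = length l then l' else l))"

text \<open>Each edge costs two deletions and two length computations, all linear in
  \<open>N\<close>. The bound on \<open>N + 2\<close> covers the sum formed in the length
  test.\<close>

lemma ev_greedy: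
  assumes "2 \<le> M" "vsize (vpairs es) \<le> M" "vsize (vpairs l) \<le> M"
    and "length l \<le> N" "vsize (VNum (N + 2)) \<le> M"
  shows "ev M prog [vpairs es, vpairs l] greedy_body (vpairs (greedy es l))
    (500 * Suc (length es) * Suc N)"
  using assms(2-4)
proof (induction es arbitrary: l)
  case Nil
  show ?case
    unfolding greedy_body_def
    apply (rule ev_eq)
      apply (rule ev_rules | use assms(1) Nil in \<open>simp; fail\<close>)+
    done
next
  case (Cons e es)
  obtain u v where [simp]: "e = (u, v)" by (cases e)
  define l1 where "l1 = filter (\<lambda>s. fst s \<noteq> v) l"
  define l2 where "l2 = filter (\<lambda>s. fst s \<noteq> u) l1"
  have sz: "vsize (vpairs l1) \<le> M" "vsize (vpairs l2) \<le> M"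
    using vsize_pairs_filter Cons.prems(2) le_trans unfolding l1_def l2_def by blast+
  have ln: "length l1 \<le> N" "length l2 \<le> N"
    using Cons.prems(3) length_filter_le le_trans unfolding l1_def l2_def by blast+
  have nm: "vsize (VNum n) \<le> M" if "n \<le> N + 2" for n
    using vsize_num_mono[OF that] assms(5) by linarith
  have nms: "vsize (VNum (length l)) \<le> M" "vsize (VNum (2 + length l2)) \<le> M"
    by (rule nm; use ln Cons.prems(3) in simp)+
  have r1: "ev M prog [VNum v, vpairs l] remove_body (vpairs l1) (100 * Suc N)"
    using Cons.prems unfolding l1_def
    by (intro ev_le[OF ev_remove[OF assms(1)]]) auto
  have r2: "ev M prog [VNum u, vpairs l1] remove_body (vpairs l2) (100 * Suc N)"
    using Cons.prems sz ln unfolding l2_def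
    by (intro ev_le[OF ev_remove[OF assms(1)]]) auto
  have r3: "ev M prog [vpairs l] len_body (VNum (length l)) (40 * Suc N)"
    using Cons.prems by (intro ev_le[OF ev_len_pairs[OF assms(1)]]) auto
  have r4: "ev M prog [vpairs l2] len_body (VNum (length l2)) (40 * Suc N)"
    using sz ln by (intro ev_le[OF ev_len_pairs[OF assms(1)]]) auto
  have IH: "ev M prog [vpairs es, vpairs l'] greedy_body (vpairs (greedy es l'))
      (500 * Suc (length es) * Suc N)" if "l' = l \<or> l' = l2" for l'
    using that Cons sz ln by auto
  have res: "greedy (e # es) l = greedy es (if length l2 + 2 = length l then l2 else l)"
    by (simp add: Let_def l1_def l2_def)
  show ?case
  proof (cases "length l2 + 2 = length l")
    case True
    then have True': "Suc (Suc (length l2)) = length l" by simp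
    show ?thesis
      unfolding greedy_body_def res
      apply (rule ev_eq)
        apply (rule ev_rules r1 r2 r3 r4 IH
          | use assms(1) Cons.prems True True' sz nms in \<open>simp; fail\<close>)+
      apply (simp add: algebra_simps)
      done
  next
    case False
    then have False': "Suc (Suc (length l2)) \<noteq> length l" by simp
    show ?thesis
      unfolding greedy_body_def res
      apply (rule ev_eq)
        apply (rule ev_rules r1 r2 r3 r4 IH
          | use assms(1) Cons.prems False False' sz nms in \<open>simp; fail\<close>)+
      apply (simp add: algebra_simps)
      done
  qed
qed

text \<open>The first argument is the shortest list met so far. At each step the longer of the two
  candidates is emitted and the other one carried on; the list carried at the end is the one
  dropped.\<close>

fun drop_smallest :: "'a list \<Rightarrow> 'a list list \<Rightarrow> 'a list list" where
  "drop_smallest xs [] = []"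
| "drop_smallest xs (ys # yss) =
    (if length ys < length xs then xs # drop_smallest ys yss else ys # drop_smallest xs yss)"

abbreviation vsets :: "nat list list \<Rightarrow> val" where
  "vsets xss \<equiv> vlist (map vnats xss)"

lemma vsize_drop_smallest: "vsize (vsets (drop_smallest xs yss)) \<le> vsize (vsets (xs # yss))"
proof (induction yss arbitrary: xs)
  case (Cons ys yss)
  show ?case using Cons[of xs] Cons[of ys] by auto
qed simp

lemma ev_drop_smallest:
  assumes "2 \<le> M" "vsize (vsets (xs # yss)) \<le> M" "\<forall>ys\<in>set (xs # yss). length ys \<le> N"
  shows "ev M prog [vnats xs, vsets yss] drop_smallest_body (vsets (drop_smallest xs yss))
    (200 * Suc (length yss) * Suc N)"
  using assms(2,3)
proof (induction yss arbitrary: xs)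
  case Nil
  show ?case
    unfolding drop_smallest_body_def
    apply (rule ev_eq)
      apply (rule ev_rules | use assms(1) Nil in \<open>simp; fail\<close>)+
    done
next
  case (Cons ys yss)
  have sz: "vsize (vsets (drop_smallest zs yss)) \<le> vsize (vsets (zs # yss))" for zs :: "nat list"
    by (rule vsize_drop_smallest)
  have nms: "vsize (VNum (length zs)) \<le> M" if "vsize (vnats zs) \<le> M" for zs
    using vsize_length[of "map VNum zs"] that unfolding vnats_def length_map by linarith
  have r1: "ev M prog [vnats zs] len_body (VNum (length zs)) (40 * Suc N)"
    if "zs = xs \<or> zs = ys" for zs
    using Cons.prems that by (intro ev_le[OF ev_len_nats[OF assms(1)]]) auto
  have IH: "ev M prog [vnats zs, vsets yss] drop_smallest_body (vsets (drop_smallest zs yss))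
    (200 * Suc (length yss) * Suc N)" if "zs = xs \<or> zs = ys" for zs
    by (rule Cons.IH) (use Cons.prems that in auto)
  show ?case
  proof (cases "length ys < length xs")
    case True
    show ?thesis
      unfolding drop_smallest_body_def
      apply (rule ev_eq)
        apply (rule ev_rules r1 IH
          | use assms(1) Cons.prems True nms[of xs] nms[of ys] sz[of ys] in \<open>simp; fail\<close>)+
      apply (simp add: algebra_simps)
      done
  next
    case False
    show ?thesis
      unfolding drop_smallest_body_def
      apply (rule ev_eq)
        apply (rule ev_rules r1 IH
          | use assms(1) Cons.prems False nms[of xs] nms[of ys] sz[of xs] in \<open>simp; fail\<close>)+
      apply (simp add: algebra_simps)
      done
  qed
qed

lemma vsize_num_trans: "vsize (VNum b) \<le> M \<Longrightarrow> a \<le> b \<Longrightarrow> vsize (VNum a) \<le> M"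
  using vsize_num_mono le_trans by blast

fun slots :: "nat \<Rightarrow> nat \<Rightarrow> nat list list \<Rightarrow> (nat \<times> nat) list" where
  "slots off b [] = []"
| "slots off b (ms # mss) = map (\<lambda>m. (m, off)) ms @ slots (off + b) b mss"

text \<open>The recursion is lexicographic, either shortening the current set or moving on to the
  next one; hence an inner induction on \<open>ms\<close> within an outer one on \<open>mss\<close>.
  The number \<open>off + length mss * b\<close> is the last offset reached.\<close>

lemma ev_slots_aux:
  assumes "2 \<le> M" "vsize (vnats ms) \<le> M" "vsize (vsets mss) \<le> M"
    and "vsize (VNum (off + length mss * b)) \<le> M" "vsize (VNum b) \<le> M"
    and "vsize (vpairs (map (\<lambda>m. (m, off)) ms @ slots (off + b) b mss)) \<le> M"
  shows "ev M prog [vnats ms, vsets mss, VNum off, VNum b] slots_aux_body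
    (vpairs (map (\<lambda>m. (m, off)) ms @ slots (off + b) b mss))
    (100 * Suc (length mss + length ms + length (concat mss)))"
  using assms(2-6)
proof (induction mss arbitrary: ms off)
  case Nil
  from Nil show ?case
  proof (induction ms)
    case Nil
    show ?case
      unfolding slots_aux_body_def
      apply (rule ev_eq)
        apply (rule ev_rules | use assms(1) Nil in \<open>simp; fail\<close>)+
      done
  next
    case (Cons m ms)
    have IH: "ev M prog [vnats ms, VNil, VNum off, VNum b] slots_aux_body
      (vpairs (map (\<lambda>m. (m, off)) ms)) (100 * Suc (length ms))"
      using Cons by simp
    show ?case
      unfolding slots_aux_body_def
      apply (rule ev_eq)
        apply (rule ev_rules IH | use assms(1) Cons.prems in \<open>simp; fail\<close>)+
      done
  qed
next
  case (Cons ms' mss)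
  note outer = Cons.IH
  from Cons.prems show ?case
  proof (induction ms)
    case Nil
    have *: "vsize (VNum (off + b)) \<le> M"
      by (rule vsize_num_trans[OF Nil(3)]) (simp add: algebra_simps)
    have **: "vsize (VNum off) \<le> M"
      by (rule vsize_num_trans[OF Nil(3)]) simp
    have IH: "ev M prog [vnats ms', vsets mss, VNum (off + b), VNum b] slots_aux_body
      (vpairs (map (\<lambda>m. (m, off + b)) ms' @ slots (off + b + b) b mss))
      (100 * Suc (length mss + length ms' + length (concat mss)))"
      by (rule outer) (use Nil in \<open>auto simp: algebra_simps\<close>)
    show ?case
      unfolding slots_aux_body_def
      apply (rule ev_eq)
        apply (rule ev_rules IH | use assms(1) Nil * ** in \<open>simp; fail\<close>)+
      done
  next
    case (Cons m ms)
    have *: "vsize (VNum off) \<le> M"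
      using vsize_num_mono[of off "off + length (ms' # mss) * b"] Cons.prems(3) by simp
    have IH: "ev M prog [vnats ms, vsets (ms' # mss), VNum off, VNum b] slots_aux_body
      (vpairs (map (\<lambda>m. (m, off)) ms @ slots (off + b) b (ms' # mss)))
      (100 * Suc (length (ms' # mss) + length ms + length (concat (ms' # mss))))"
      by (rule Cons.IH) (use Cons.prems in auto)
    show ?case
      unfolding slots_aux_body_def
      apply (rule ev_eq)
        apply (rule ev_rules IH[unfolded list.map vlist_simps] | use assms(1) Cons.prems * in \<open>simp; fail\<close>)+
      done
  qed
qed

lemma ev_slots:
  assumes "2 \<le> M" "vsize (vsets mss) \<le> M"
    and "vsize (VNum (length mss * b)) \<le> M" "vsize (VNum b) \<le> M"
    and "vsize (vpairs (slots 0 b mss)) \<le> M"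
  shows "ev M prog [vsets mss, VNum b] slots_body (vpairs (slots 0 b mss))
    (200 * Suc (length mss + length (concat mss)))"
proof (cases mss)
  case Nil
  have IH: "ev M prog [VNil, VNil, VNum 0, VNum b] slots_aux_body VNil 100"
    using ev_slots_aux[of M "[]" "[]" 0 b] assms by simp
  show ?thesis
    unfolding slots_body_def
    apply (rule ev_eq)
      apply (rule ev_rules IH | use assms Nil in \<open>simp; fail\<close>)+
    done
next
  case (Cons ms mss')
  have *: "vsize (VNum (length mss' * b)) \<le> M"
    by (rule vsize_num_trans[OF assms(3)]) (simp add: Cons)
  have IH: "ev M prog [vnats ms, vsets mss', VNum 0, VNum b] slots_aux_body
    (vpairs (slots 0 b mss)) (100 * Suc (length mss' + length ms + length (concat mss')))"
    using ev_slots_aux[of M ms mss' 0 b] assms Cons * by auto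
  show ?thesis
    unfolding slots_body_def
    apply (rule ev_eq)
      apply (rule ev_rules IH | use assms Cons * in \<open>simp; fail\<close>)+
    done
qed

definition starts :: "(nat \<times> nat) list \<Rightarrow> nat \<Rightarrow> nat \<Rightarrow> nat" where
  "starts sl Q j = (j div length sl) * Q + snd (sl ! (j mod length sl))"

definition assigned :: "(nat \<times> nat) list \<Rightarrow> nat \<Rightarrow> nat" where
  "assigned sl j = fst (sl ! (j mod length sl))"

definition vjobs :: "(nat \<times> nat) list \<Rightarrow> nat \<Rightarrow> nat \<Rightarrow> nat \<Rightarrow> nat \<Rightarrow> val" where
  "vjobs sl Q D j k =
     vlist (map (\<lambda>j. VCons (VNum (assigned sl j)) (VCons (VNum (starts sl Q j)) (VNum D))) [j..<k])"

lemma vpairs_drop: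
  "i < length l \<Longrightarrow> vpairs (drop i l) = VCons (VCons (VNum (fst (l ! i))) (VNum (snd (l ! i)))) (vpairs (drop (Suc i) l))"
  by (cases "l ! i") (simp add: Cons_nth_drop_Suc[symmetric])

lemma vsize_drop: "vsize (vpairs (drop i l)) \<le> vsize (vpairs l)"
proof (induction l arbitrary: i)
  case (Cons s l)
  obtain a b where "s = (a, b)" by (cases s)
  then show ?case using Cons[of "i - 1"] by (cases i) auto
qed simp

text \<open>A state is a position \<open>r * length sl + i\<close>. The value
  \<open>i = length sl\<close> is allowed: it is the moment when a round is used up but not yet
  reloaded. Each reload is followed by a served job, so \<open>(r + n + 1) * Q\<close> dominates
  every base time.\<close>

lemma ev_assign:
  assumes "2 \<le> M" "sl \<noteq> []" "vsize (vpairs sl) \<le> M" "vsize (VNum Q) \<le> M" "vsize (VNum D) \<le> M"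
    and "i \<le> length sl"
    and "vsize (vlist (replicate n VNil)) \<le> M"
    and "vsize (VNum ((r + n + 1) * Q)) \<le> M"
    and "vsize (vjobs sl Q D (r * length sl + i) (r * length sl + i + n)) \<le> M"
  shows "ev M prog [vlist (replicate n VNil), vpairs (drop i sl), vpairs sl, VNum (r * Q), VNum Q, VNum D]
    assign_body (vjobs sl Q D (r * length sl + i) (r * length sl + i + n)) (300 * Suc n)"
  using assms(6-9)
proof (induction n arbitrary: r i)
  case 0
  have *: "vsize (VNum (r * Q)) \<le> M"
    by (rule vsize_num_trans[OF 0(3)]) (simp add: algebra_simps)
  have **: "vsize (vpairs (drop i sl)) \<le> M" using vsize_drop[of i sl] assms(3) by linarith
  show ?case
    unfolding assign_body_def
    apply (rule ev_eq)
      apply (rule ev_rules | use assms(1-5) 0 * ** in \<open>simp add: vjobs_def; fail\<close>)+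
    done
next
  case (Suc n)
  \<comment> \<open>Serves one job from an existing slot. Only 150 of the 300 steps allotted to a
    job are spent, which leaves the rest for a reload beforehand.\<close>
  have step: "ev M prog [vlist (replicate (Suc n) VNil), vpairs (drop i sl), vpairs sl, VNum (r * Q), VNum Q, VNum D]
    assign_body (vjobs sl Q D (r * length sl + i) (r * length sl + i + Suc n)) (300 * Suc n + 150)"
    if i: "i < length sl" and big: "vsize (VNum ((r + n + 1) * Q)) \<le> M"
      and out: "vsize (vjobs sl Q D (r * length sl + i) (r * length sl + i + Suc n)) \<le> M" for r i
  proof -
    have *: "vsize (VNum (r * Q)) \<le> M"
      by (rule vsize_num_trans[OF big]) (simp add: algebra_simps)
    have d: "vsize (vpairs (drop i sl)) \<le> M" using vsize_drop[of i sl] assms(3) by linarith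
    have dm: "(r * length sl + i) div length sl = r" "(r * length sl + i) mod length sl = i"
      using i by (auto simp: div_nat_eqI)
    have j: "vjobs sl Q D (r * length sl + i) (r * length sl + i + Suc n) =
       VCons (VCons (VNum (fst (sl ! i))) (VCons (VNum (r * Q + snd (sl ! i))) (VNum D)))
         (vjobs sl Q D (r * length sl + Suc i) (r * length sl + Suc i + n))"
      unfolding vjobs_def
      using i by (subst upt_conv_Cons) (auto simp: starts_def assigned_def dm)
    have IH: "ev M prog [vlist (replicate n VNil), vpairs (drop (Suc i) sl), vpairs sl, VNum (r * Q), VNum Q, VNum D]
      assign_body (vjobs sl Q D (r * length sl + Suc i) (r * length sl + Suc i + n)) (300 * Suc n)"
      by (rule Suc.IH) (use i Suc.prems(2) out[unfolded j] big in auto)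
    show ?thesis
      unfolding assign_body_def j
      apply (rule ev_eq)
        apply (rule ev_rules IH
          | use assms(1-5) Suc.prems(2) * d[unfolded vpairs_drop[OF i]] out[unfolded j] in \<open>simp add: vpairs_drop[OF i]; fail\<close>)+
      done
  qed
  show ?case
  proof (cases "i < length sl")
    case True
    have "vsize (VNum ((r + n + 1) * Q)) \<le> M"
      by (rule vsize_num_trans[OF Suc.prems(3)]) (simp add: algebra_simps)
    from ev_le[OF step[OF True this Suc.prems(4)]] show ?thesis by simp
  next
    case False
    then have i: "i = length sl" using Suc.prems(1) by simp
    have eq: "r * length sl + i = (r + 1) * length sl + 0" by (simp add: i)
    have IH: "ev M prog [vlist (replicate (Suc n) VNil), vpairs sl, vpairs sl, VNum (r * Q + Q), VNum Q, VNum D]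
      assign_body (vjobs sl Q D (r * length sl + i) (r * length sl + i + Suc n)) (300 * Suc n + 150)"
      using step[of 0 "r + 1"] assms(2) Suc.prems(3,4) unfolding eq by (simp add: algebra_simps)
    have *: "vsize (VNum (r * Q)) \<le> M"
      by (rule vsize_num_trans[OF Suc.prems(3)]) (simp add: algebra_simps)
    have **: "vsize (VNum (r * Q + Q)) \<le> M"
      by (rule vsize_num_trans[OF Suc.prems(3)]) (simp add: algebra_simps)
    have IH': "ev M prog [VCons VNil (vlist (replicate n VNil)), vpairs sl, vpairs sl, VNum (r * Q + Q), VNum Q, VNum D]
      assign_body (vjobs sl Q D (r * length sl + i) (r * length sl + i + Suc n)) (300 * Suc n + 150)"
      using IH by simp
    show ?thesis
      unfolding assign_body_def
      apply (rule ev_eq)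
        apply (rule ev_rules IH' | use assms(1-5) Suc.prems(2) * ** i in \<open>simp; fail\<close>)+
      done
  qed
qed

lemma ev_assign_all:
  assumes "2 \<le> M" "sl \<noteq> []" "vsize (vpairs sl) \<le> M" "vsize (VNum Q) \<le> M" "vsize (VNum D) \<le> M"
    and "vsize (vlist (replicate n VNil)) \<le> M"
    and "vsize (VNum ((n + 1) * Q)) \<le> M"
    and "vsize (vjobs sl Q D 0 n) \<le> M"
  shows "ev M prog [vlist (replicate n VNil), vpairs sl, vpairs sl, VNum 0, VNum Q, VNum D]
    assign_body (vjobs sl Q D 0 n) (300 * Suc n)"
  using ev_assign[of M sl Q D 0 n 0] assms by simp

definition kept :: "nat \<Rightarrow> nat list list \<Rightarrow> nat list list" where
  "kept f xss = (if f + 1 < length xss then drop_smallest (hd xss) (tl xss) else xss)"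

definition choose_slots ::
  "nat \<Rightarrow> (nat \<times> nat) list \<Rightarrow> (nat \<times> nat) list \<Rightarrow> nat \<Rightarrow> nat \<Rightarrow> (nat \<times> nat) list \<times> nat" where
  "choose_slots n sl xl q Q =
    (if 2 * length sl < n \<and> n \<le> 3 * length xl then (xl, q) else (sl, Q))"

lemma ev_choose:
  assumes "2 \<le> M" "sl \<noteq> []" "length sl \<le> N" "length xl \<le> N" "n \<le> N"
    and "vsize (vpairs sl) \<le> M" "vsize (vpairs xl) \<le> M"
    and "vsize (VNum D) \<le> M" "vsize (VNum (3 * N)) \<le> M"
    and "vsize (vlist (replicate n VNil)) \<le> M"
    and "vsize (VNum ((n + 1) * q)) \<le> M" "vsize (VNum ((n + 1) * Q)) \<le> M"
    and "xl \<noteq> [] \<Longrightarrow> vsize (vjobs xl q D 0 n) \<le> M" "vsize (vjobs sl Q D 0 n) \<le> M"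
    and choice: "choose_slots n sl xl q Q = (l, T)"
  shows "ev M prog [vlist (replicate n VNil), vpairs sl, vpairs xl, VNum q, VNum Q, VNum D]
    choose_body (vjobs l T D 0 n) (1000 * Suc N)"
proof -
  have num: "vsize (VNum (length sl)) \<le> M" "vsize (VNum (length xl)) \<le> M" "vsize (VNum n) \<le> M"
    "vsize (VNum (2 * length sl)) \<le> M" "vsize (VNum (3 * length xl)) \<le> M"
    by (rule vsize_num_trans[OF assms(9)]; use assms(3-5) in simp)+
  have three: "3 \<le> M"
    using vsize_num_trans[OF assms(9), of 3] assms(2,3) by (cases sl) auto
  have per: "vsize (VNum q) \<le> M" "vsize (VNum Q) \<le> M"
    using vsize_num_trans[OF assms(11)] vsize_num_trans[OF assms(12)] by simp_all
  have r1: "ev M prog [vlist (replicate n VNil)] len_body (VNum n) (40 * Suc N)"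
    using ev_le[OF ev_len[OF assms(1,10)], of "40 * Suc N"] assms(5) by simp
  have r2: "ev M prog [vpairs sl] len_body (VNum (length sl)) (40 * Suc N)"
    using ev_le[OF ev_len_pairs[OF assms(1,6)], of "40 * Suc N"] assms(3) by simp
  have r3: "ev M prog [vpairs xl] len_body (VNum (length xl)) (40 * Suc N)"
    using ev_le[OF ev_len_pairs[OF assms(1,7)], of "40 * Suc N"] assms(4) by simp
  have r4: "ev M prog [vlist (replicate n VNil), vpairs sl, vpairs sl, VNum 0, VNum Q, VNum D]
    assign_body (vjobs sl Q D 0 n) (300 * Suc N)"
    using ev_le[OF ev_assign_all, of M sl Q D n "300 * Suc N"] assms per by simp
  consider "\<not> 2 * length sl < n" | "2 * length sl < n" "3 * length xl < n"
    | "2 * length sl < n" "\<not> 3 * length xl < n"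
    by blast
  then show ?thesis
  proof cases
    case 1
    then have [simp]: "l = sl" "T = Q" using choice by (auto simp: choose_slots_def)
    show ?thesis
      unfolding choose_body_def
      apply (rule ev_eq)
        apply (rule ev_rules r1 r2 r3 r4 | use assms(1-14) per num three 1 in \<open>simp; fail\<close>)+
      done
  next
    case 2
    then have [simp]: "l = sl" "T = Q" using choice by (auto simp: choose_slots_def)
    show ?thesis
      unfolding choose_body_def
      apply (rule ev_eq)
        apply (rule ev_rules r1 r2 r3 r4 | use assms(1-14) per num three 2 in \<open>simp; fail\<close>)+
      done
  next
    case 3
    then have [simp]: "l = xl" "T = q" using choice by (auto simp: choose_slots_def)
    have xl: "xl \<noteq> []" using 3 by auto
    then have r5: "ev M prog [vlist (replicate n VNil), vpairs xl, vpairs xl, VNum 0, VNum q, VNum D]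
      assign_body (vjobs xl q D 0 n) (300 * Suc N)"
      using ev_le[OF ev_assign_all, of M xl q D n "300 * Suc N"] assms per by simp
    show ?thesis
      unfolding choose_body_def
      apply (rule ev_eq)
        apply (rule ev_rules r1 r2 r3 r5 | use assms(1-14) per num three 3 xl in \<open>simp; fail\<close>)+
      done
  qed
qed

definition plan ::
  "nat \<Rightarrow> (nat \<times> nat) list \<Rightarrow> nat list list \<Rightarrow> nat \<Rightarrow> nat \<Rightarrow> nat \<Rightarrow> (nat \<times> nat) list \<times> nat" where
  "plan n es xss B P q =
    choose_slots n (slots 0 B (kept (P div B) xss)) (greedy es (slots 0 0 xss))
      q (q + P div B * B)"

section \<open>Properties of the list functions\<close>

lemma length_drop_smallest [simp]: "length (drop_smallest xs yss) = length yss"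
  by (induction yss arbitrary: xs) auto

text \<open>Multisets are used because carrying the shortest list along permutes the family. The
  list \<open>m\<close> is the dropped one; the head of the recursive call is either
  \<open>m\<close> itself or survives, so it is at least as long as \<open>m\<close>.\<close>

lemma mset_drop_smallest:
  "\<exists>m. mset (xs # yss) = add_mset m (mset (drop_smallest xs yss)) \<and>
    (\<forall>ys\<in>set (drop_smallest xs yss). length m \<le> length ys)"
proof (induction yss arbitrary: xs)
  case (Cons ys yss)
  show ?case
  proof (cases "length ys < length xs")
    case True
    obtain m where m: "mset (ys # yss) = add_mset m (mset (drop_smallest ys yss))"
      "\<forall>zs\<in>set (drop_smallest ys yss). length m \<le> length zs"
      using Cons.IH by blast
    have "m \<in># mset (ys # yss)" unfolding m(1) by simp
    have "length m \<le> length ys"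
    proof (cases "m = ys")
      case False
      have "ys \<in># add_mset m (mset (drop_smallest ys yss))" unfolding m(1)[symmetric] by simp
      then show ?thesis using m(2) False by auto
    qed simp
    moreover have "mset (xs # ys # yss) = add_mset m (mset (drop_smallest xs (ys # yss)))"
      using True m(1) by (simp add: add_mset_commute)
    ultimately have "mset (xs # ys # yss) = add_mset m (mset (drop_smallest xs (ys # yss))) \<and>
      (\<forall>zs\<in>set (drop_smallest xs (ys # yss)). length m \<le> length zs)"
      using m(2) True by auto
    then show ?thesis by blast
  next
    case False
    obtain m where m: "mset (xs # yss) = add_mset m (mset (drop_smallest xs yss))"
      "\<forall>zs\<in>set (drop_smallest xs yss). length m \<le> length zs"
      using Cons.IH by blast
    have "length m \<le> length xs"
    proof (cases "m = xs")
      case False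
      have "xs \<in># add_mset m (mset (drop_smallest xs yss))" unfolding m(1)[symmetric] by simp
      then show ?thesis using m(2) False by auto
    qed simp
    moreover have "mset (xs # ys # yss) = add_mset ys (mset (xs # yss))" by simp
    ultimately show ?thesis using m False by (intro exI[of _ m]) (auto simp: add_mset_commute)
  qed
qed simp

lemma map_fst_slots [simp]: "map fst (slots off b mss) = concat mss"
  by (induction mss arbitrary: off) (auto simp: comp_def)

lemma length_slots [simp]: "length (slots off b mss) = length (concat mss)"
  using map_fst_slots by (metis length_map)

lemma slots_mem:
  "(m, a) \<in> set (slots off b mss) \<Longrightarrow> \<exists>i<length mss. m \<in> set (mss ! i) \<and> a = off + i * b"
proof (induction mss arbitrary: off)
  case (Cons ms mss)
  show ?case
  proof (cases "m \<in> set ms \<and> a = off")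
    case False
    then have "(m, a) \<in> set (slots (off + b) b mss)" using Cons.prems by auto
    then obtain i where "i < length mss" "m \<in> set (mss ! i)" "a = off + b + i * b"
      using Cons.IH by blast
    then show ?thesis by (intro exI[of _ "Suc i"]) auto
  qed auto
qed simp

lemma greedy_subset: "set (greedy es l) \<subseteq> set l"
proof (induction es l rule: greedy.induct)
  case (2 u v es l)
  let ?l' = "filter (\<lambda>s. fst s \<noteq> u) (filter (\<lambda>s. fst s \<noteq> v) l)"
  have "set (if length ?l' + 2 = length l then ?l' else l) \<subseteq> set l" by auto
  with 2[OF refl] show ?case
    unfolding greedy.simps Let_def by (rule subset_trans)
qed simp

lemma vsize_greedy: "vsize (vpairs (greedy es l)) \<le> vsize (vpairs l)"
proof (induction es l rule: greedy.induct)
  case (2 u v es l)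
  then show ?case
    using vsize_pairs_filter[of "\<lambda>s. fst s \<noteq> u" "filter (\<lambda>s. fst s \<noteq> v) l"]
      vsize_pairs_filter[of "\<lambda>s. fst s \<noteq> v" l]
    by (auto simp: Let_def)
qed simp

lemma length_greedy: "length (greedy es l) \<le> length l"
proof (induction es l rule: greedy.induct)
  case (2 u v es l)
  then show ?case
    using length_filter_le[of "\<lambda>s. fst s \<noteq> u" "filter (\<lambda>s. fst s \<noteq> v) l"]
      length_filter_le[of "\<lambda>s. fst s \<noteq> v" l]
    by (auto simp: Let_def)
qed simp

lemma mset_kept:
  "mset (kept f xss) \<subseteq># mset xss"
proof (cases "f + 1 < length xss")
  case True
  then obtain xs yss where "xss = xs # yss" by (cases xss) auto
  then show ?thesis using mset_drop_smallest[of xs yss] True by (auto simp: kept_def)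
qed (simp add: kept_def)

lemma set_kept: "set (kept f xss) \<subseteq> set xss"
  using set_mset_mono[OF mset_kept[of f xss]] by simp

lemma length_kept: "length (kept f xss) \<le> length xss"
  using size_mset_mono[OF mset_kept[of f xss]] by simp

text \<open>Transfers distinctness of the machines from the given sets to the kept ones, in spite of
  the permutation.\<close>

lemma mset_concat_kept: "mset (concat (kept f xss)) \<subseteq># mset (concat xss)"
proof -
  have eq: "mset (concat yss) = sum_mset (image_mset mset (mset yss))" for yss :: "nat list list"
    by (induction yss) auto
  obtain R where "mset xss = mset (kept f xss) + R"
    using mset_kept[of f xss] by (auto simp: mset_subset_eq_exists_conv)
  then show ?thesis by (simp add: eq)
qed

lemma length_concat_kept: "length (concat (kept f xss)) \<le> length (concat xss)"
  using size_mset_mono[OF mset_concat_kept] by (metis size_mset)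

lemma vsize_kept: "vsize (vsets (kept f xss)) \<le> vsize (vsets xss)"
proof (cases "f + 1 < length xss")
  case True
  then obtain xs yss where "xss = xs # yss" by (cases xss) auto
  then show ?thesis using vsize_drop_smallest[of xs yss] True by (auto simp: kept_def)
qed (simp add: kept_def)

text \<open>The quadratic bound stems from \<open>greedy\<close>, which scans the slots for every
  edge, and from \<open>drop_smallest\<close>, which measures two lists at every set. The bounds on
  \<open>P + 1\<close> and \<open>3 * N + 2\<close> cover the numbers compared in the tests.\<close>

lemma ev_slots_choice:
  fixes xss es n B P q D
  defines "sl \<equiv> slots 0 B (kept (P div B) xss)"
    and "xl \<equiv> greedy es (slots 0 0 xss)" and "Q \<equiv> q + P div B * B"
  assumes "2 \<le> M" "sl \<noteq> []" "n \<le> N" "length xss \<le> N" "length (concat xss) \<le> N" "length es \<le> N"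
    and sz: "vsize (vpairs es) \<le> M" "vsize (vsets xss) \<le> M"
      "vsize (vpairs sl) \<le> M" "vsize (vpairs (slots 0 0 xss)) \<le> M"
      "vsize (vlist (replicate n VNil)) \<le> M"
      "xl \<noteq> [] \<Longrightarrow> vsize (vjobs xl q D 0 n) \<le> M" "vsize (vjobs sl Q D 0 n) \<le> M"
    and num: "vsize (VNum (3 * N + 2)) \<le> M" "vsize (VNum D) \<le> M" "vsize (VNum (P + 1)) \<le> M"
      "vsize (VNum (N * B)) \<le> M" "vsize (VNum B) \<le> M"
      "vsize (VNum ((n + 1) * q)) \<le> M" "vsize (VNum ((n + 1) * Q)) \<le> M"
    and choice: "plan n es xss B P q = (l, T)"
  shows "ev M prog [vpairs es, vlist (replicate n VNil), vsets xss, VNum D, VNum B, VNum P, VNum q]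
    slots_choice_body (vjobs l T D 0 n) (5000 * (Suc N * Suc N))"
proof -
  have small: "vsize (VNum a) \<le> M" if "a \<le> P + 1 \<or> a \<le> 3 * N + 2 \<or> a \<le> N * B \<or> a \<le> q \<or> a \<le> Q" for a
  proof -
    have "vsize (VNum q) \<le> M" "vsize (VNum Q) \<le> M"
      using vsize_num_trans[OF num(6)] vsize_num_trans[OF num(7)] by simp_all
    then show ?thesis using that num vsize_num_trans by blast
  qed
  have N2: "Suc N \<le> Suc N * Suc N" by simp
  have len: "length sl \<le> N" "length xl \<le> N"
    using length_concat_kept[of "P div B" xss] length_greedy[of es "slots 0 0 xss"] assms(8)
    by (simp_all add: sl_def xl_def)
  have elem: "length ys \<le> N" if "ys \<in> set xss" for ys
  proof -
    from split_list[OF that] obtain as bs where "xss = as @ ys # bs" by blast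
    then show ?thesis using assms(8) by auto
  qed
  have r1: "ev M prog [vsets xss] len_body (VNum (length xss)) (40 * (Suc N * Suc N))"
    using ev_le[OF ev_len[OF assms(4) sz(2)], of "40 * (Suc N * Suc N)"] assms(7) N2 by simp
  have k1: "length (kept (P div B) xss) + length (concat (kept (P div B) xss)) \<le> 2 * N"
    using length_kept[of "P div B" xss] length_concat_kept[of "P div B" xss] assms(7,8) by linarith
  have r2: "ev M prog [vsets (kept (P div B) xss), VNum B] slots_body (vpairs sl) (400 * (Suc N * Suc N))"
    unfolding sl_def
  proof (rule ev_le[OF ev_slots[OF assms(4)]])
    show "vsize (vsets (kept (P div B) xss)) \<le> M" using vsize_kept sz(2) le_trans by blast
    show "vsize (VNum (length (kept (P div B) xss) * B)) \<le> M"
      by (rule small) (meson length_kept assms(7) le_trans mult_le_mono1)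
    show "vsize (VNum B) \<le> M" by (rule num)
    show "vsize (vpairs (slots 0 B (kept (P div B) xss))) \<le> M" using sz(3) by (simp add: sl_def)
    have "200 * Suc (length (kept (P div B) xss) + length (concat (kept (P div B) xss))) \<le> 400 * Suc N"
      using k1 by simp
    also have "\<dots> \<le> 400 * (Suc N * Suc N)" using N2 mult_le_mono2 by blast
    finally show "200 * Suc (length (kept (P div B) xss) + length (concat (kept (P div B) xss)))
      \<le> 400 * (Suc N * Suc N)" .
  qed
  have r3: "ev M prog [vsets xss, VNum 0] slots_body (vpairs (slots 0 0 xss)) (400 * (Suc N * Suc N))"
  proof (rule ev_le[OF ev_slots[OF assms(4)]])
    have "200 * Suc (length xss + length (concat xss)) \<le> 400 * Suc N"
      using assms(7,8) by simp
    also have "\<dots> \<le> 400 * (Suc N * Suc N)" using N2 mult_le_mono2 by blast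
    finally show "200 * Suc (length xss + length (concat xss)) \<le> 400 * (Suc N * Suc N)" .
  qed (use sz assms(4) in auto)
  have r4: "ev M prog [vpairs es, vpairs (slots 0 0 xss)] greedy_body (vpairs xl) (500 * (Suc N * Suc N))"
    unfolding xl_def
  proof (rule ev_le[OF ev_greedy[OF assms(4) sz(1)]])
    show "vsize (vpairs (slots 0 0 xss)) \<le> M" by (rule sz)
    show "length (slots 0 0 xss) \<le> N" using assms(8) by simp
    show "vsize (VNum (N + 2)) \<le> M" by (rule small) simp
    show "500 * Suc (length es) * Suc N \<le> 500 * (Suc N * Suc N)"
      using assms(9) by (simp only: mult.assoc) (intro mult_le_mono2 mult_le_mono1, simp)
  qed
  have r5: "ev M prog [vlist (replicate n VNil), vpairs sl, vpairs xl, VNum q, VNum Q, VNum D]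
    choose_body (vjobs l T D 0 n) (1000 * (Suc N * Suc N))"
  proof (rule ev_le[OF ev_choose[OF assms(4,5) len assms(6)]])
    show "choose_slots n sl xl q Q = (l, T)"
      using choice by (simp add: plan_def sl_def xl_def Q_def)
    show "vsize (vpairs xl) \<le> M" using vsize_greedy sz(4) le_trans unfolding xl_def by blast
    show "vsize (VNum (3 * N)) \<le> M" by (rule small) simp
    show "1000 * Suc N \<le> 1000 * (Suc N * Suc N)" using N2 mult_le_mono2 by blast
  qed (use sz num in auto)
  have nums: "vsize (VNum (P div B)) \<le> M" "vsize (VNum (Suc (P div B))) \<le> M" "vsize (VNum P) \<le> M"
    "vsize (VNum (length xss)) \<le> M" "vsize (VNum q) \<le> M" "vsize (VNum Q) \<le> M"
    "vsize (VNum (P div B * B)) \<le> M"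
    by (rule small; use assms(7) div_le_dividend[of P B] in \<open>simp add: Q_def le_SucI\<close>)+
  have cond: "ev M prog [vpairs es, vlist (replicate n VNil), vsets xss, VNum D, VNum B, VNum P, VNum q]
    (Cond (Binary PLess (Binary PAdd (Num 1) (Binary PDiv (Var 5) (Var 4))) (len_call (Var 2)))
       (drop_smallest_call (hd_expr (Var 2)) (tl_expr (Var 2))) (Var 2))
    (vsets (kept (P div B) xss)) (300 * (Suc N * Suc N) + 100)"
  proof (cases "P div B + 1 < length xss")
    case True
    then obtain ys yss where xss: "xss = ys # yss" by (cases xss) auto
    have r: "ev M prog [vnats ys, vsets yss] drop_smallest_body (vsets (kept (P div B) xss)) (200 * (Suc N * Suc N))"
    proof -
      have "ev M prog [vnats ys, vsets yss] drop_smallest_body (vsets (drop_smallest ys yss)) (200 * (Suc N * Suc N))"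
      proof (rule ev_le[OF ev_drop_smallest[OF assms(4)]])
        show "vsize (vsets (ys # yss)) \<le> M" "\<forall>zs\<in>set (ys # yss). length zs \<le> N"
          using sz(2) elem xss by auto
        show "200 * Suc (length yss) * Suc N \<le> 200 * (Suc N * Suc N)"
          using assms(7) xss by (simp only: mult.assoc) (intro mult_le_mono2 mult_le_mono1, simp)
      qed
      then show ?thesis using True by (simp add: kept_def xss)
    qed
    have M2: "2 \<le> M" by (rule assms(4))
    have lt: "Suc (P div B) < length xss" "P div B < length yss" using True xss by auto
    have h: "apply_unop PHead (vsets xss) = vnats ys" "apply_unop PTail (vsets xss) = vsets yss"
      by (simp_all add: xss)
    show ?thesis
      apply (rule ev_eq)
        apply (rule ev_rules r r1 | use nums num sz M2 lt h in \<open>simp; fail\<close>)+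
      done
  next
    case False
    have M2: "2 \<le> M" by (rule assms(4))
    have lt: "\<not> Suc (P div B) < length xss" using False by auto
    have h: "kept (P div B) xss = xss" using False by (simp add: kept_def)
    show ?thesis
      apply (rule ev_eq)
        apply (rule ev_rules r1 | use nums num sz M2 lt h in \<open>simp; fail\<close>)+
      done
  qed
  show ?thesis
    \<comment> \<open>\<open>cond\<close> stands before \<open>ev_rules\<close>, so that the
      conditional is executed as one unit rather than by \<open>ev_CondI\<close>.\<close>
    unfolding slots_choice_body_def
    apply (rule ev_eq)
      apply (rule cond ev_rules r1 r2 r3 r4 r5[unfolded Q_def] | use nums num sz assms(4) Q_def in \<open>simp; fail\<close>)+
    done
qed

section \<open>Running time\<close>

definition vfrac :: "nat \<Rightarrow> nat \<Rightarrow> val" where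
  "vfrac a d = VCons (VNum a) (VNum d)"

lemma ev_scale:
  fixes a1 d1 ap dp a2 d2 :: nat
  defines "D \<equiv> d1 * (dp * d2)" and "B \<equiv> a1 * (dp * d2)" and "P \<equiv> ap * (d1 * d2)"
    and "B2 \<equiv> a2 * (d1 * dp)"
  assumes "\<And>x. x \<in> {xE, jobs, xJ} \<Longrightarrow> vsize x \<le> M"
    and "vsize (vfrac a1 d1) \<le> M" "vsize (vfrac ap dp) \<le> M" "vsize (vfrac a2 d2) \<le> M"
    and "vsize (VNum D) \<le> M" "vsize (VNum (B + (P + B2))) \<le> M"
    and "vsize (VNum (dp * d2)) \<le> M" "vsize (VNum (d1 * d2)) \<le> M" "vsize (VNum (d1 * dp)) \<le> M"
    and call: "ev M prog [xE, jobs, xJ, VNum D, VNum B, VNum P, VNum (B + (P + B2))]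
      slots_choice_body y k"
  shows "ev M prog [xE, jobs, xJ, vfrac a1 d1, vfrac ap dp, vfrac a2 d2] scale_body y (k + 500)"
proof -
  have nums: "vsize (VNum B) \<le> M" "vsize (VNum P) \<le> M" "vsize (VNum B2) \<le> M" "vsize (VNum (P + B2)) \<le> M"
    by (rule vsize_num_trans[OF assms(10)]; simp)+
  show ?thesis
    unfolding scale_body_def Let_def
    apply (rule ev_eq)
      apply (rule ev_rules call[unfolded B_def P_def B2_def D_def]
        | use assms(5-9) assms(10-13) nums in \<open>simp add: vfrac_def D_def B_def P_def B2_def; fail\<close>)+
    done
qed

lemma ev_unpack:
  assumes "x = VCons (vlist [xV, xE, jobs, x1, xp, x2]) xJ" "vsize x \<le> M"
    and call: "ev M prog [xE, jobs, xJ, x1, xp, x2] scale_body y k"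
  shows "ev M prog [x] unpack_body y (k + 500)"
  unfolding unpack_body_def Let_def
  apply (simp add: eval_nat_numeral)
  apply (rule ev_eq)
    apply (rule ev_rules call | use assms(1,2) in \<open>simp; fail\<close>)+
  done

section \<open>Bit lengths and the polynomial time bound\<close>

lemma vsize_pairs_le:
  assumes "\<And>a b. (a, b) \<in> set l \<Longrightarrow> a < 2 ^ w \<and> b < 2 ^ w"
  shows "vsize (vpairs l) \<le> 1 + length l * (4 + 2 * w)"
  using assms
proof (induction l)
  case (Cons s l)
  obtain a b where s: "s = (a, b)" by (cases s)
  have "vsize (VNum a) \<le> Suc w" "vsize (VNum b) \<le> Suc w"
    using Cons.prems s by (auto intro!: vsize_num_le[of _ w] simp del: vsize.simps)
  moreover have "vsize (vpairs l) \<le> 1 + length l * (4 + 2 * w)"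
    using Cons by auto
  ultimately show ?case by (simp add: s)
qed simp

lemma vsize_jobs_le:
  assumes "\<And>j. j < n \<Longrightarrow> assigned sl j < 2 ^ w \<and> starts sl Q j < 2 ^ w" "D < 2 ^ w"
  shows "vsize (vjobs sl Q D 0 n) \<le> 1 + n * (6 + 3 * w)"
proof -
  have D: "vsize (VNum D) \<le> Suc w" using assms(2) by (rule vsize_num_le)
  have "vsize (vlist (map (\<lambda>j. VCons (VNum (assigned sl j)) (VCons (VNum (starts sl Q j)) (VNum D))) js))
    \<le> 1 + length js * (6 + 3 * w)" if "\<forall>j\<in>set js. j < n" for js
    using that
  proof (induction js)
    case (Cons j js)
    have "vsize (VNum (assigned sl j)) \<le> Suc w" "vsize (VNum (starts sl Q j)) \<le> Suc w"
      using assms(1)[of j] Cons.prems by (auto intro!: vsize_num_le[of _ w] simp del: vsize.simps)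
    then show ?case using Cons D by simp
  qed simp
  from this[of "[0..<n]"] show ?thesis by (simp add: vjobs_def)
qed

lemma num_less_power_vsize: "n < 2 ^ vsize (VNum n)"
proof -
  have "n < 2 ^ floorlog 2 n" using floorlog_leD[of 2 n "floorlog 2 n"] by simp
  also have "(2::nat) ^ floorlog 2 n \<le> 2 ^ vsize (VNum n)" by (intro power_increasing) auto
  finally show ?thesis .
qed

lemma vsize_elem: "v \<in> set vs \<Longrightarrow> vsize v < vsize (vlist vs)"
  by (induction vs) auto

lemma length_le_vsize: "length vs \<le> vsize (vlist vs)"
  by (induction vs) auto

lemma length_concat_le_vsize: "length (concat xss) \<le> vsize (vsets xss)"
proof (induction xss)
  case (Cons xs xss)
  then show ?case using length_le_vsize[of "map VNum xs"] by (simp add: vnats_def)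
qed simp


lemma starts_bound:
  assumes "\<And>m a. (m, a) \<in> set sl \<Longrightarrow> m < A \<and> a < C" "sl \<noteq> []" "j < n"
  shows "assigned sl j < A" "starts sl Q j < n * Q + C"
proof -
  have "j mod length sl < length sl" using assms(2) by simp
  then have *: "(fst (sl ! (j mod length sl)), snd (sl ! (j mod length sl))) \<in> set sl"
    by simp
  then show "assigned sl j < A" using assms(1) unfolding assigned_def by blast
  have "snd (sl ! (j mod length sl)) < C" using * assms(1) by blast
  moreover have "j div length sl \<le> n" using assms(3) div_le_dividend[of j "length sl"] by linarith
  ultimately show "starts sl Q j < n * Q + C"
    unfolding starts_def by (meson add_le_less_mono mult_le_mono1)
qed

text \<open>For inputs of size \<open>z\<close>, every number formed is dominated by a product of
  boundedly many factors below \<open>2 ^ z\<close>, so it has O(z) bits. Every list has at most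
  \<open>z\<close> entries, so all values have size O(z^2). With O(z^2) steps the time is
  O(z^4).\<close>

lemma runs_prog:
  fixes V es xss n a1 d1 ap dp a2 d2
  defines "D \<equiv> d1 * (dp * d2)" and "B \<equiv> a1 * (dp * d2)" and "P \<equiv> ap * (d1 * d2)"
    and "B2 \<equiv> a2 * (d1 * dp)"
  defines "q \<equiv> B + (P + B2)"
  assumes x: "x = VCons (vlist [xV, vpairs es, vlist (replicate n VNil),
      vfrac a1 d1, vfrac ap dp, vfrac a2 d2]) (vsets xss)"
    and ne: "slots 0 B (kept (P div B) xss) \<noteq> []"
    and choice: "plan n es xss B P q = (l, T)"
  shows "\<exists>t. runs prog x (vjobs l T D 0 n) t \<and> t \<le> 1000000 * vsize x ^ 4"
proof -
  define z where "z = vsize x"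
  \<comment> \<open>With \<open>Y = 2 ^ z\<close>, scaled times are of order \<open>Y ^ 3\<close>,
    and the largest numbers, starting times after up to \<open>z\<close> rounds, of order
    \<open>Y ^ 4\<close>. The bound \<open>2 ^ w = Y ^ 8\<close> absorbs the constant factors, and
    \<open>M\<close> then holds \<open>z\<close> entries of a few numbers with \<open>w\<close> bits
    each.\<close>
  define w where "w = 8 * z"
  define M where "M = 40 * (z * z)"
  define Q where "Q = q + P div B * B"
  define sl where "sl = slots 0 B (kept (P div B) xss)"
  define xl where "xl = greedy es (slots 0 0 xss)"
  have z10: "10 \<le> z" using vsize_pos[of xV] vsize_pos[of "vlist (replicate n VNil)"] by (simp add: z_def x)
  then have zz: "10 * z \<le> z * z" by simp
  have zM: "z \<le> M" using zz unfolding M_def by linarith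
  have sz: "vsize (vpairs es) \<le> z" "vsize (vlist (replicate n VNil)) \<le> z" "vsize (vsets xss) \<le> z"
    "vsize (vfrac a1 d1) \<le> z" "vsize (vfrac ap dp) \<le> z" "vsize (vfrac a2 d2) \<le> z"
    by (auto simp: z_def x)
  have n_z: "n \<le> z" "length xss \<le> z" "length es \<le> z" "length (concat xss) \<le> z"
    using length_le_vsize[of "replicate n VNil"] length_le_vsize[of "map vnats xss"]
      length_le_vsize[of "map (\<lambda>(a, b). VCons (VNum a) (VNum b)) es"]
      length_concat_le_vsize[of xss] sz(1-3)
    by (simp_all add: vpairs_def)
  have pw: "a < 2 ^ z" if "vsize (VNum a) \<le> z" for a
    using num_less_power_vsize[of a] that power_increasing[of "vsize (VNum a)" z "2::nat"]
    by linarith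
  have par: "a1 < 2 ^ z" "d1 < 2 ^ z" "ap < 2 ^ z" "dp < 2 ^ z" "a2 < 2 ^ z" "d2 < 2 ^ z"
    by (rule pw; use sz(4-6) in \<open>simp add: vfrac_def\<close>)+
  define Y :: nat where "Y = 2 ^ z"
  have mul2: "a * b \<le> Y * Y" if "a < Y" "b < Y" for a b
    using that by (intro mult_le_mono) auto
  have mul3: "a * (b * c) \<le> Y * (Y * Y)" if "a < Y" "b < Y" "c < Y" for a b c
    using that by (intro mult_le_mono) auto
  have DB: "D \<le> Y * (Y * Y)" "B \<le> Y * (Y * Y)" "P \<le> Y * (Y * Y)" "B2 \<le> Y * (Y * Y)"
    unfolding D_def B_def P_def B2_def using par mul3 unfolding Y_def by blast+
  have Y1024: "1024 \<le> Y" using power_increasing[OF z10, of "2::nat"] by (simp add: Y_def)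
  define X where "X = Y * (Y * Y)"
  have XY: "X * Y * 6 + Y + 100 < 2 ^ w" "Y * Y \<le> X" "Y \<le> X" "z < Y"
  proof -
    have 1: "1024 * 1 \<le> Y * (Y * (Y * Y))" using Y1024 by (intro mult_le_mono) auto
    have 2: "Y \<le> X * Y" using Y1024 by (simp add: X_def)
    have "X * Y * 6 + Y + 100 \<le> X * Y * 6 + X * Y + X * Y * 100"
      using 2 Y1024 by linarith
    also have "\<dots> < X * Y * 1024" using 1 Y1024 by (simp add: X_def)
    also have "\<dots> \<le> X * Y * (X * Y)" using 1 by (intro mult_le_mono2) (simp add: X_def algebra_simps)
    also have "\<dots> = 2 ^ w"
      by (simp add: X_def Y_def w_def power_add[symmetric] mult_2[symmetric])
    finally show "X * Y * 6 + Y + 100 < 2 ^ w" .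
    show "Y * Y \<le> X" "Y \<le> X" using Y1024 by (simp_all add: X_def)
    show "z < Y" using less_exp[of z] by (simp add: Y_def)
  qed
  have wM: "Suc w \<le> M" using zz z10 unfolding w_def M_def by linarith
  have zw: "z * (4 + 2 * w) = 4 * z + 16 * (z * z)" "z * (6 + 3 * w) = 6 * z + 24 * (z * z)"
    by (simp_all add: w_def algebra_simps)
  have fits: "vsize (VNum a) \<le> M" if "a < 2 ^ w" for a
    using vsize_num_le[OF that] wM by linarith
  have XY': "X \<le> X * Y" using Y1024 by simp
  have DX: "D \<le> X" "B \<le> X" "P \<le> X" "B2 \<le> X" using DB by (simp_all only: X_def)
  have q: "q \<le> 3 * X" using DB by (simp add: q_def X_def)
  have fB: "P div B * B \<le> X" unfolding X_def by (rule le_trans[OF div_times_less_eq_dividend DB(3)])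
  have Q: "Q \<le> 4 * X" using q fB by (simp add: Q_def)
  have nY: "n + 1 \<le> Y" using n_z(1) XY(4) by linarith
  have per: "(n + 1) * q \<le> X * Y * 4" "(n + 1) * Q \<le> X * Y * 4"
    using mult_le_mono[OF nY q] mult_le_mono[OF nY Q] by (simp_all add: algebra_simps)
  have zB: "z * B \<le> X * Y" using mult_le_mono[of z Y B X] XY(4) DX by (simp add: mult.commute)
  have mach: "m < Y" if "ys \<in> set xss" "m \<in> set ys" for ys m
  proof -
    have "vsize (VNum m) < vsize (vnats ys)" using that(2) vsize_elem[of "VNum m" "map VNum ys"]
      by (simp add: vnats_def)
    also have "\<dots> < vsize (vsets xss)" using that(1) vsize_elem[of "vnats ys" "map vnats xss"] by simp
    finally show ?thesis using pw[of m] sz(3) unfolding Y_def by linarith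
  qed
  have mem: "m < Y \<and> a \<le> X * Y" if "(m, a) \<in> set sl \<or> (m, a) \<in> set (slots 0 0 xss)" for m a
    using that
  proof
    assume "(m, a) \<in> set sl"
    then obtain i where i: "i < length (kept (P div B) xss)" "m \<in> set (kept (P div B) xss ! i)" "a = i * B"
      using slots_mem[of m a 0 B] unfolding sl_def by auto
    have "kept (P div B) xss ! i \<in> set xss" using set_kept i(1) nth_mem by blast
    moreover have "a \<le> z * B" using i(1,3) length_kept[of "P div B" xss] n_z(2) by simp
    ultimately show ?thesis using mach i(2) zB by force
  next
    assume "(m, a) \<in> set (slots 0 0 xss)"
    then obtain i where "i < length xss" "m \<in> set (xss ! i)" "a = 0"
      using slots_mem[of m a 0 0] by auto
    then show ?thesis using mach nth_mem by force
  qed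
  have mem_sl: "m < 2 ^ w \<and> a < 2 ^ w" if "(m, a) \<in> set sl \<or> (m, a) \<in> set (slots 0 0 xss)" for m a
    using mem[OF that] XY by linarith
  have pairs: "vsize (vpairs l) \<le> M"
    if "length l \<le> z" "\<And>m a. (m, a) \<in> set l \<Longrightarrow> m < 2 ^ w \<and> a < 2 ^ w" for l
  proof -
    have "vsize (vpairs l) \<le> 1 + length l * (4 + 2 * w)" by (rule vsize_pairs_le) (rule that)
    also have "\<dots> \<le> 1 + z * (4 + 2 * w)" using that(1) by simp
    also have "\<dots> \<le> M" using zz z10 unfolding M_def zw by linarith
    finally show ?thesis .
  qed
  have lens: "length sl \<le> z" "length (slots 0 0 xss) \<le> z"
    using length_concat_kept[of "P div B" xss] n_z(4) by (simp_all add: sl_def)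
  have jobs: "vsize (vjobs l Q' D 0 n) \<le> M"
    if "\<And>m a. (m, a) \<in> set l \<Longrightarrow> m < Y \<and> a \<le> X * Y" "Q' \<le> 4 * X" "l \<noteq> []" for l Q'
  proof -
    have "vsize (vjobs l Q' D 0 n) \<le> 1 + n * (6 + 3 * w)"
    proof (rule vsize_jobs_le)
      fix j assume j: "j < n"
      have "\<And>m a. (m, a) \<in> set l \<Longrightarrow> m < Y \<and> a < X * Y + 1" using that(1) by force
      from starts_bound(1)[OF this that(3) j] starts_bound(2)[OF this that(3) j, of Q']
      have "assigned l j < Y" "starts l Q' j < n * Q' + (X * Y + 1)" by auto
      moreover have "n * Q' \<le> X * Y * 4"
        using mult_le_mono[of n Y Q' "4 * X"] nY that(2) by (simp add: algebra_simps)
      ultimately show "assigned l j < 2 ^ w \<and> starts l Q' j < 2 ^ w"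
        using XY XY' by linarith
    next
      show "D < 2 ^ w" using DX XY XY' by linarith
    qed
    also have "\<dots> \<le> 1 + z * (6 + 3 * w)" using n_z(1) by simp
    also have "\<dots> \<le> M" using zz z10 unfolding M_def zw by linarith
    finally show ?thesis .
  qed
  have main: "ev M prog [vpairs es, vlist (replicate n VNil), vsets xss, VNum D, VNum B, VNum P, VNum q]
    slots_choice_body (vjobs l T D 0 n) (5000 * (Suc z * Suc z))"
  proof (rule ev_slots_choice)
    show "2 \<le> M" using zM z10 by linarith
    show "vsize (vpairs (slots 0 B (kept (P div B) xss))) \<le> M"
      using pairs[OF lens(1)] mem_sl unfolding sl_def by blast
    show "vsize (vpairs (slots 0 0 xss)) \<le> M"
      using pairs[OF lens(2)] mem_sl by blast
    show "vsize (vjobs (greedy es (slots 0 0 xss)) q D 0 n) \<le> M" if "greedy es (slots 0 0 xss) \<noteq> []"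
    proof (rule jobs)
      show "m < Y \<and> a \<le> X * Y" if "(m, a) \<in> set (greedy es (slots 0 0 xss))" for m a
        using mem that greedy_subset[of es "slots 0 0 xss"] by blast
    qed (use q that in auto)
    show "vsize (vjobs (slots 0 B (kept (P div B) xss)) (q + P div B * B) D 0 n) \<le> M"
      by (rule jobs) (use mem Q ne in \<open>auto simp: sl_def Q_def\<close>)
    show "vsize (VNum (3 * z + 2)) \<le> M" by (rule fits) (use XY XY' in linarith)
    show "vsize (VNum D) \<le> M" by (rule fits) (use XY XY' DX in linarith)
    show "vsize (VNum (P + 1)) \<le> M" by (rule fits) (use XY XY' DX in linarith)
    show "vsize (VNum B) \<le> M" by (rule fits) (use XY XY' DX in linarith)
    show "vsize (VNum (z * B)) \<le> M" by (rule fits) (use XY zB in linarith)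
    show "vsize (VNum ((n + 1) * q)) \<le> M" by (rule fits) (use XY XY' per in linarith)
    show "vsize (VNum ((n + 1) * (q + P div B * B))) \<le> M"
      by (rule fits) (use XY XY' per in \<open>unfold Q_def, linarith\<close>)
  qed (use ne choice n_z sz zM in auto)
  have scale: "ev M prog [vpairs es, vlist (replicate n VNil), vsets xss, vfrac a1 d1, vfrac ap dp, vfrac a2 d2]
    scale_body (vjobs l T D 0 n) (5000 * (Suc z * Suc z) + 500)"
  proof (rule ev_scale)
    show "vsize (VNum (d1 * (dp * d2))) \<le> M"
      using fits[of D] XY XY' DX unfolding D_def by linarith
    show "vsize (VNum (a1 * (dp * d2) + (ap * (d1 * d2) + a2 * (d1 * dp)))) \<le> M"
      using fits[of q] XY XY' q unfolding q_def B_def P_def B2_def by linarith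
    have "a * b < 2 ^ w" if "a < 2 ^ z" "b < 2 ^ z" for a b :: nat
      using mul2[of a b] that XY XY' unfolding Y_def by linarith
    then show "vsize (VNum (dp * d2)) \<le> M" "vsize (VNum (d1 * d2)) \<le> M" "vsize (VNum (d1 * dp)) \<le> M"
      using par fits by auto
    show "ev M prog [vpairs es, vlist (replicate n VNil), vsets xss, VNum (d1 * (dp * d2)),
       VNum (a1 * (dp * d2)), VNum (ap * (d1 * d2)),
       VNum (a1 * (dp * d2) + (ap * (d1 * d2) + a2 * (d1 * dp)))]
     slots_choice_body (vjobs l T D 0 n) (5000 * (Suc z * Suc z))"
      using main by (simp only: q_def D_def B_def P_def B2_def)
  qed (use sz zM in auto)
  have "ev M prog [x] unpack_body (vjobs l T D 0 n) (5000 * (Suc z * Suc z) + 500 + 500)"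
    by (rule ev_unpack[OF x _ scale]) (use zM z_def in simp)
  then have "ev M prog [x] (prog ! 0) (vjobs l T D 0 n) (5000 * (Suc z * Suc z) + 1000)"
    by simp
  moreover have "evs M prog [x] [Var 0] [x] 2"
    using evs_Cons[OF ev_VarI[of 0 "[x]" x M prog] evs_Nil] zM by (simp add: z_def)
  ultimately have "ev M prog [x] (Call 0 [Var 0]) (vjobs l T D 0 n) (5000 * (Suc z * Suc z) + 1004)"
    by (intro ev_le[OF ev_Call]) auto
  then obtain t where t: "runs prog x (vjobs l T D 0 n) t" "t \<le> (5000 * (Suc z * Suc z) + 1004) * M"
    unfolding ev_def runs_def by blast
  \<comment> \<open>At most \<open>25000 * z ^ 2\<close> steps of cost \<open>M = 40 * z ^ 2\<close>
    give the constant 1000000.\<close>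
  have "Suc z * Suc z = z * z + 2 * z + 1" by simp
  then have "Suc z * Suc z \<le> 2 * (z * z)" using zz z10 by linarith
  then have "5000 * (Suc z * Suc z) + 1004 \<le> 25000 * (z * z)" using zz z10 by linarith
  then have "t \<le> 25000 * (z * z) * M" using t(2) mult_le_mono1 le_trans by blast
  also have "\<dots> = 1000000 * z ^ 4" by (simp add: M_def power4_eq_xxxx)
  finally show ?thesis using t(1) unfolding z_def by blast
qed

section \<open>Schedules consisting of rounds\<close>

definition job_schedule :: "(nat \<times> nat) list \<Rightarrow> nat \<Rightarrow> nat \<Rightarrow> schedule" where
  "job_schedule sl Q D = \<lparr>machine_of = assigned sl, start = (\<lambda>j. real (starts sl Q j) / real D)\<rparr>"

lemma represents_job_schedule:
  assumes "D > 0"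
  shows "represents_schedule (vjobs sl Q D 0 (njobs I)) I (job_schedule sl Q D)"
  unfolding represents_schedule_def vjobs_def represents_real_def job_schedule_def
  by (rule exI, rule conjI[rotated], rule conjI, rule refl) (use assms in auto)

lemma ordered_open_disjoint:
  fixes a b c d :: real
  shows "b \<le> c \<Longrightarrow> {a<..<b} \<inter> {c<..<d} = {}"
  by auto

text \<open>The first block of \<open>j\<close> ends before \<open>j'\<close> starts. Completions
  are also at least \<open>block1 I\<close> apart, so \<open>block2 I \<le> block1 I\<close>
  separates the two second blocks. The remaining pair is the second block of \<open>j\<close> and
  the first block of \<open>j'\<close>: the latter ends before the former begins if
  \<open>j'\<close> starts at most \<open>p\<close> later, and it follows the former if
  \<open>j\<close> is already completed.\<close>

lemma blocks_disjoint:
  assumes "start \<sigma> j + block1 I \<le> start \<sigma> j'"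
    and "start \<sigma> j' \<le> start \<sigma> j + ptime I \<or> completion I \<sigma> j \<le> start \<sigma> j'"
    and "block2 I \<le> block1 I" "0 \<le> block1 I" "0 \<le> ptime I"
    and "X \<in> blocking_intervals I \<sigma> j" "Y \<in> blocking_intervals I \<sigma> j'"
  shows "interior X \<inter> interior Y = {}"
  using assms
  by (auto simp: blocking_intervals_def completion_def system_time_def min_le_iff_disj le_max_iff_disj)

lemma slot_mem:
  assumes "sl \<noteq> []"
  shows "(assigned sl j, snd (sl ! (j mod length sl))) \<in> set sl"
  using assms by (simp add: assigned_def)

text \<open>Conditions on a single round, in units of \<open>1 / D\<close>, under which its
  repetition is feasible. The main plan and the fallback are both instances; in the fallback
  \<open>gap\<close> holds vacuously, because its machines are pairwise nonadjacent.\<close>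

locale slot_plan =
  fixes I :: smc_instance and sl :: "(nat \<times> nat) list" and B P B2 D Q :: nat
  assumes D: "D > 0" and sl: "sl \<noteq> []" "distinct (map fst sl)"
    and times: "block1 I = real B / real D" "ptime I = real P / real D" "block2 I = real B2 / real D"
    and B2: "B2 \<le> B"
    and slot: "\<And>m a. (m, a) \<in> set sl \<Longrightarrow> m \<in> machines I \<and> a + (B + P + B2) \<le> Q"
    and gap: "\<And>m a m' a'. (m, a) \<in> set sl \<Longrightarrow> (m', a') \<in> set sl \<Longrightarrow> {m, m'} \<in> conflicts I \<Longrightarrow>
      a \<le> a' \<Longrightarrow> a + B \<le> a' \<and> a' \<le> a + P"
begin

lemma completion_eq:
  "completion I (job_schedule sl Q D) j = real (starts sl Q j + (B + P + B2)) / real D"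
  by (simp add: completion_def job_schedule_def system_time_def times add_divide_distrib)

lemma starts_round_le: "starts sl Q j + (B + P + B2) \<le> Suc (j div length sl) * Q"
  using slot[OF slot_mem[OF sl(1), of j]] by (simp add: starts_def)

lemma starts_next_round:
  assumes "j div length sl < j' div length sl"
  shows "starts sl Q j + (B + P + B2) \<le> starts sl Q j'"
proof -
  have "starts sl Q j + (B + P + B2) \<le> Suc (j div length sl) * Q" by (rule starts_round_le)
  also have "\<dots> \<le> (j' div length sl) * Q" using assms by (intro mult_le_mono1) simp
  finally show ?thesis by (simp add: starts_def)
qed

text \<open>Jobs of different rounds do not overlap in time. Within a round the machines are
  distinct, and \<open>gap\<close> puts jobs on adjacent machines into the situation of
  \<open>blocks_disjoint\<close>.\<close>

lemma conflict_free_job_schedule: "conflict_free I (job_schedule sl Q D)"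
proof -
  let ?\<sigma> = "job_schedule sl Q D"
  have start [simp]: "start ?\<sigma> j = real (starts sl Q j) / real D" for j
    by (simp add: job_schedule_def)
  have mach [simp]: "machine_of ?\<sigma> j = assigned sl j" for j
    by (simp add: job_schedule_def)
  have seq: "completion I ?\<sigma> j \<le> start ?\<sigma> j'" if "j div length sl < j' div length sl" for j j'
    using starts_next_round[OF that] D by (simp add: completion_eq divide_right_mono del: of_nat_add)
  have same: "{start ?\<sigma> j<..<completion I ?\<sigma> j} \<inter> {start ?\<sigma> j'<..<completion I ?\<sigma> j'} = {}"
    if "j \<noteq> j'" "assigned sl j = assigned sl j'" for j j'
  proof -
    have "j mod length sl < length sl" "j' mod length sl < length sl" using sl by simp_all
    then have "j mod length sl = j' mod length sl"
      using that(2) nth_eq_iff_index_eq[OF sl(2), of "j mod length sl" "j' mod length sl"]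
      by (simp add: assigned_def)
    with \<open>j \<noteq> j'\<close> have "j div length sl \<noteq> j' div length sl"
      by (metis div_mult_mod_eq)
    then consider "j div length sl < j' div length sl" | "j' div length sl < j div length sl"
      by linarith
    then show ?thesis
      by cases (use seq ordered_open_disjoint in \<open>force\<close>)+
  qed
  have sep: "start ?\<sigma> j + block1 I \<le> start ?\<sigma> j' \<and>
      (start ?\<sigma> j' \<le> start ?\<sigma> j + ptime I \<or> completion I ?\<sigma> j \<le> start ?\<sigma> j')"
    if "{assigned sl j, assigned sl j'} \<in> conflicts I" "starts sl Q j \<le> starts sl Q j'"
      "j div length sl \<le> j' div length sl" for j j'
  proof (cases "j div length sl < j' div length sl")
    case True
    have "starts sl Q j + B \<le> starts sl Q j'" using starts_next_round[OF True] by simp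
    then have "real (starts sl Q j + B) / D \<le> real (starts sl Q j') / D"
      by (intro divide_right_mono of_nat_mono) simp_all
    then have "start ?\<sigma> j + block1 I \<le> start ?\<sigma> j'"
      by (simp add: times add_divide_distrib)
    then show ?thesis using seq[OF True] by blast
  next
    case False
    then have eq: "j div length sl = j' div length sl" using that(3) by simp
    have "starts sl Q j + B \<le> starts sl Q j' \<and> starts sl Q j' \<le> starts sl Q j + P"
      using gap[OF slot_mem[OF sl(1), of j] slot_mem[OF sl(1), of j'] that(1)] that(2) eq
      by (simp add: starts_def)
    then have "real (starts sl Q j + B) / D \<le> real (starts sl Q j') / D"
      "real (starts sl Q j') / D \<le> real (starts sl Q j + P) / D"
      by (auto intro!: divide_right_mono of_nat_mono simp del: of_nat_add)
    then show ?thesis by (simp add: times add_divide_distrib)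
  qed
  have order: "j div length sl \<le> j' div length sl" if "starts sl Q j < starts sl Q j'" for j j'
    using starts_next_round[of j' j] that by linarith
  have blocks: "interior X \<inter> interior Y = {}"
    if "{assigned sl j, assigned sl j'} \<in> conflicts I"
      "X \<in> blocking_intervals I ?\<sigma> j" "Y \<in> blocking_intervals I ?\<sigma> j'" for j j' X Y
  proof -
    have nn: "block2 I \<le> block1 I" "0 \<le> block1 I" "0 \<le> ptime I"
      using B2 by (auto simp: times divide_right_mono)
    \<comment> \<open>Two jobs can be ordered by start and round simultaneously: a strictly earlier
      start cannot lie in a later round, and equal starts are ordered by the round.\<close>
    have "starts sl Q j \<le> starts sl Q j' \<and> j div length sl \<le> j' div length sl \<or>
      starts sl Q j' \<le> starts sl Q j \<and> j' div length sl \<le> j div length sl"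
      using order[of j j'] order[of j' j] by linarith
    then show ?thesis
    proof
      assume "starts sl Q j \<le> starts sl Q j' \<and> j div length sl \<le> j' div length sl"
      then show ?thesis using blocks_disjoint[OF _ _ nn that(2,3)] sep[OF that(1)] by blast
    next
      assume "starts sl Q j' \<le> starts sl Q j \<and> j' div length sl \<le> j div length sl"
      moreover have "{assigned sl j', assigned sl j} \<in> conflicts I"
        using that(1) by (simp add: insert_commute)
      ultimately have "interior Y \<inter> interior X = {}"
        using blocks_disjoint[OF _ _ nn that(3,2)] sep by blast
      then show ?thesis by blast
    qed
  qed
  show ?thesis
    unfolding conflict_free_def
    using same blocks slot slot_mem[OF sl(1)] by (auto; blast)
qed

text \<open>The number of rounds is the ceiling of \<open>njobs I / length sl\<close>, written with
  natural division for \<open>njobs I \<ge> 1\<close>.\<close>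

lemma makespan_job_schedule:
  assumes "njobs I \<ge> 1"
  shows "makespan I (job_schedule sl Q D) \<le> real (Suc ((njobs I - 1) div length sl)) * real Q / real D"
  unfolding makespan_def
proof (rule Max.boundedI)
  fix x assume "x \<in> completion I (job_schedule sl Q D) ` {..<njobs I}"
  then obtain j where j: "j < njobs I" "x = completion I (job_schedule sl Q D) j" by auto
  have "j div length sl \<le> (njobs I - 1) div length sl"
    using j(1) by (intro div_le_mono) simp
  then have "Suc (j div length sl) * Q \<le> Suc ((njobs I - 1) div length sl) * Q"
    by (intro mult_le_mono1) simp
  then have "starts sl Q j + (B + P + B2) \<le> Suc ((njobs I - 1) div length sl) * Q"
    using starts_round_le[of j] by linarith
  then have "real (starts sl Q j + (B + P + B2)) \<le> real (Suc ((njobs I - 1) div length sl) * Q)"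
    by (rule of_nat_mono)
  then show "x \<le> real (Suc ((njobs I - 1) div length sl)) * real Q / real D"
    using D unfolding j(2) completion_eq of_nat_mult by (intro divide_right_mono) simp_all
qed (use assms in \<open>auto simp: lessThan_empty_iff\<close>)

end

section \<open>The lower bound\<close>

text \<open>\<open>Max\<close> is meaningful here: there are infinitely many families, as their
  values from \<open>c\<close> on are free, but all sizes lie in \<open>{..card V}\<close>.\<close>

lemma c_IS_size_le_alpha:
  assumes "finite V" "c_IS V E c J"
  shows "c_IS_size c J \<le> alpha c V E"
  unfolding alpha_def
proof (rule Max_ge)
  have "{c_IS_size c J |J. c_IS V E c J} \<subseteq> {..card V}"
  proof
    fix k assume "k \<in> {c_IS_size c J |J. c_IS V E c J}"
    then obtain J where J: "k = c_IS_size c J" "c_IS V E c J" by blast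
    then have "(\<Union>i<c. J i) \<subseteq> V" by (auto simp: c_IS_def independent_set_def)
    then show "k \<in> {..card V}"
      using card_mono[OF assms(1)] J(1) by (simp add: c_IS_size_def)
  qed
  then show "finite {c_IS_size c J |J. c_IS V E c J}" by (rule finite_subset) simp
qed (use assms(2) in blast)

locale feasible_schedule =
  fixes I :: smc_instance and \<sigma> :: schedule
  assumes inst: "smc_id I" and times: "ordered_times I" and feasible: "conflict_free I \<sigma>"
begin

abbreviation "V \<equiv> machines I"
abbreviation "E \<equiv> conflicts I"
abbreviation "q \<equiv> system_time I"

lemma pos: "0 < block2 I" "block2 I \<le> block1 I" "block1 I \<le> ptime I" "0 < q"
  using times by (auto simp: ordered_times_def system_time_def)

lemma graph: "finite V" "\<And>u. {u, u} \<notin> E"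
  using inst by (auto simp: smc_id_def simple_graph_def doubleton_eq_iff)

lemma same_machine:
  assumes "j < njobs I" "j' < njobs I" "j \<noteq> j'" "machine_of \<sigma> j = machine_of \<sigma> j'"
    and "start \<sigma> j \<le> start \<sigma> j'"
  shows "q \<le> start \<sigma> j' - start \<sigma> j"
proof (rule ccontr)
  assume "\<not> ?thesis"
  then have "max (start \<sigma> j) (start \<sigma> j') < min (completion I \<sigma> j) (completion I \<sigma> j')"
    using assms(5) pos by (auto simp: completion_def)
  then obtain x where "max (start \<sigma> j) (start \<sigma> j') < x" "x < min (completion I \<sigma> j) (completion I \<sigma> j')"
    using dense by blast
  then have "x \<in> {start \<sigma> j<..<completion I \<sigma> j} \<inter> {start \<sigma> j'<..<completion I \<sigma> j'}" by auto
  then show False using feasible assms(1-4) unfolding conflict_free_def by blast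
qed

text \<open>Two jobs on adjacent machines with starting times less than \<open>b\<close> apart collide in their first
  blocking intervals; if the difference lies strictly between \<open>p\<close> and \<open>q\<close>, then the second blocking
  interval of the earlier job meets the first one of the later job.\<close>

lemma adjacent_machines:
  assumes "j < njobs I" "j' < njobs I" "{machine_of \<sigma> j, machine_of \<sigma> j'} \<in> E"
    and "start \<sigma> j \<le> start \<sigma> j'"
  defines "d \<equiv> start \<sigma> j' - start \<sigma> j"
  shows "block1 I \<le> d" "d \<le> ptime I \<or> q \<le> d"
proof -
  let ?F = "\<lambda>j. {start \<sigma> j .. start \<sigma> j + block1 I}"
  let ?S = "\<lambda>j. {completion I \<sigma> j - block2 I .. completion I \<sigma> j}"
  have blocks: "interior X \<inter> interior Y = {}"
    if "X \<in> blocking_intervals I \<sigma> j" "Y \<in> blocking_intervals I \<sigma> j'" for X Y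
    using feasible assms(1-3) that unfolding conflict_free_def by blast
  have *: "interior (?F j) \<inter> interior (?F j') = {}" "interior (?S j) \<inter> interior (?F j') = {}"
    by (rule blocks; simp add: blocking_intervals_def)+
  show "block1 I \<le> d"
    using *(1) assms(4) pos by (auto simp: d_def min_le_iff_disj le_max_iff_disj)
  show "d \<le> ptime I \<or> q \<le> d"
    using *(2) assms(4) pos
    by (auto simp: d_def completion_def system_time_def min_le_iff_disj le_max_iff_disj)
qed

definition job_class :: "real \<Rightarrow> nat \<Rightarrow> nat" where
  "job_class \<tau> j = (let u = start \<sigma> j - \<tau> in
     if u < block1 I \<or> ptime I + block1 I \<le> u then 0 else nat \<lfloor>u / block1 I\<rfloor>)"

lemma job_class_0:
  assumes "\<tau> \<le> start \<sigma> j"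
  shows "job_class \<tau> j = 0 \<longleftrightarrow> start \<sigma> j - \<tau> < block1 I \<or> ptime I + block1 I \<le> start \<sigma> j - \<tau>"
proof -
  have "1 \<le> \<lfloor>(start \<sigma> j - \<tau>) / block1 I\<rfloor>" if "block1 I \<le> start \<sigma> j - \<tau>"
    using that pos by (simp add: le_floor_iff le_divide_eq)
  then show ?thesis by (cases "start \<sigma> j - \<tau> < block1 I") (simp_all add: job_class_def Let_def)
qed

text \<open>Outside class 0 the quotient \<open>u / b\<close> is below \<open>p / b + 1\<close>, so
  its floor is at most the ceiling of \<open>p / b\<close>.\<close>

lemma job_class_less: "job_class \<tau> j < num_sets I"
proof -
  let ?u = "start \<sigma> j - \<tau>"
  have "nat \<lfloor>?u / block1 I\<rfloor> < num_sets I" if "?u < ptime I + block1 I"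
  proof -
    have "?u / block1 I < (ptime I + block1 I) / block1 I"
      using that pos by (intro divide_strict_right_mono) auto
    also have "\<dots> = ptime I / block1 I + 1" using pos by (simp add: add_divide_distrib)
    finally have "?u / block1 I < ptime I / block1 I + 1" .
    then have "\<lfloor>?u / block1 I\<rfloor> \<le> \<lceil>ptime I / block1 I\<rceil>" by linarith
    then show ?thesis by (simp add: num_sets_def less_Suc_eq_le nat_mono)
  qed
  then show ?thesis by (auto simp: job_class_def Let_def num_sets_def)
qed

text \<open>Jobs on adjacent machines in one window start between \<open>b\<close> and
  \<open>p\<close> apart. In a positive class the distance is below \<open>b\<close>. In class 0 it
  is below \<open>b\<close> within either end of the window, the last part having length
  \<open>block2 I \<le> b\<close>, and it exceeds \<open>p\<close> from one end to the
  other.\<close>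

lemma same_class_nonadjacent:
  assumes "j < njobs I" "j' < njobs I" "start \<sigma> j \<le> start \<sigma> j'"
    and win: "\<tau> \<le> start \<sigma> j" "start \<sigma> j' < \<tau> + q"
    and cls: "job_class \<tau> j = job_class \<tau> j'"
  shows "{machine_of \<sigma> j, machine_of \<sigma> j'} \<notin> E"
proof
  assume "{machine_of \<sigma> j, machine_of \<sigma> j'} \<in> E"
  from adjacent_machines[OF assms(1,2) this assms(3)] win
  have d: "block1 I \<le> start \<sigma> j' - start \<sigma> j" "start \<sigma> j' - start \<sigma> j \<le> ptime I" by auto
  show False
  proof (cases "job_class \<tau> j = 0")
    case True
    then have "start \<sigma> j - \<tau> < block1 I \<or> ptime I + block1 I \<le> start \<sigma> j - \<tau>"
      "start \<sigma> j' - \<tau> < block1 I \<or> ptime I + block1 I \<le> start \<sigma> j' - \<tau>"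
      using job_class_0[of \<tau> j] job_class_0[of \<tau> j'] win assms(3) cls by linarith+
    then show False using d win pos by (auto simp: system_time_def)
  next
    case False
    have pos': "\<lfloor>(start \<sigma> j - \<tau>) / block1 I\<rfloor> \<ge> 0" "\<lfloor>(start \<sigma> j' - \<tau>) / block1 I\<rfloor> \<ge> 0"
      using win assms(3) pos by (simp_all add: zero_le_floor)
    have "nat \<lfloor>(start \<sigma> j - \<tau>) / block1 I\<rfloor> = nat \<lfloor>(start \<sigma> j' - \<tau>) / block1 I\<rfloor>"
      using False cls by (auto simp: job_class_def Let_def split: if_splits)
    then have "\<lfloor>(start \<sigma> j - \<tau>) / block1 I\<rfloor> = \<lfloor>(start \<sigma> j' - \<tau>) / block1 I\<rfloor>"
      using pos' by linarith
    then have "(start \<sigma> j' - \<tau>) / block1 I < (start \<sigma> j - \<tau>) / block1 I + 1" by linarith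
    then show False using d(1) pos by (simp add: field_simps)
  qed
qed

lemma inj_on_window:
  assumes "A \<subseteq> {..<njobs I}" "\<And>j. j \<in> A \<Longrightarrow> \<tau> \<le> start \<sigma> j \<and> start \<sigma> j < \<tau> + q"
  shows "inj_on (machine_of \<sigma>) A"
proof (rule inj_onI, rule ccontr)
  fix j j' assume *: "j \<in> A" "j' \<in> A" "machine_of \<sigma> j = machine_of \<sigma> j'" "j \<noteq> j'"
  then show False
    using same_machine[of j j'] same_machine[of j' j] assms(1) assms(2)[of j] assms(2)[of j']
    by (cases "start \<sigma> j \<le> start \<sigma> j'") auto
qed

lemma machine_mem: "j < njobs I \<Longrightarrow> machine_of \<sigma> j \<in> V"
  using feasible by (simp add: conflict_free_def)

text \<open>Jobs on the same machine start at least \<open>q\<close> apart, so in a half-open window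
  of length \<open>q\<close> a machine determines its job. Hence the classes use disjoint sets of
  machines and no job is lost in counting machines.\<close>

lemma card_window:
  assumes A: "A \<subseteq> {..<njobs I}" and win: "\<And>j. j \<in> A \<Longrightarrow> \<tau> \<le> start \<sigma> j \<and> start \<sigma> j < \<tau> + q"
  shows "card A \<le> alpha (num_sets I) V E"
proof -
  define J where "J i = machine_of \<sigma> ` {j \<in> A. job_class \<tau> j = i}" for i
  have inj: "inj_on (machine_of \<sigma>) A" using assms by (rule inj_on_window)
  have "independent_set V E (J i)" for i
    unfolding independent_set_def
  proof (intro conjI ballI)
    show "J i \<subseteq> V" using A machine_mem by (auto simp: J_def)
    fix u v assume "u \<in> J i" "v \<in> J i"
    then obtain j j' where j: "j \<in> A" "job_class \<tau> j = i" "u = machine_of \<sigma> j"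
      and j': "j' \<in> A" "job_class \<tau> j' = i" "v = machine_of \<sigma> j'"
      by (auto simp: J_def)
    show "{u, v} \<notin> E"
    proof (cases "start \<sigma> j \<le> start \<sigma> j'")
      case True
      then show ?thesis using same_class_nonadjacent[of j j' \<tau>] j j' A win by auto
    next
      case False
      then have "{v, u} \<notin> E" using same_class_nonadjacent[of j' j \<tau>] j j' A win by auto
      then show ?thesis by (simp add: insert_commute)
    qed
  qed
  moreover have "disjoint_family_on J {..<num_sets I}"
    using inj by (auto simp: disjoint_family_on_def J_def inj_on_def)
  ultimately have "c_IS_size (num_sets I) J \<le> alpha (num_sets I) V E"
    by (intro c_IS_size_le_alpha graph) (simp add: c_IS_def)
  moreover have "(\<Union>i<num_sets I. J i) = machine_of \<sigma> ` A"
    using job_class_less by (auto simp: J_def)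
  ultimately show ?thesis using card_image[OF inj] by (simp add: c_IS_size_def)
qed

lemma start_le_makespan: "j < njobs I \<Longrightarrow> start \<sigma> j + q \<le> makespan I \<sigma>"
  unfolding makespan_def completion_def by (intro Max_ge) auto

lemma start_nonneg: "j < njobs I \<Longrightarrow> 0 \<le> start \<sigma> j"
  using feasible by (simp add: conflict_free_def)

text \<open>The last start is at \<open>makespan - q\<close> at the latest, so the windows that
  contain starts have indices below the floor of \<open>makespan / q\<close>; this is why the floor
  suffices instead of the ceiling.\<close>

lemma njobs_le: "njobs I \<le> alpha (num_sets I) V E * nat \<lfloor>makespan I \<sigma> / q\<rfloor>"
proof -
  let ?N = "nat \<lfloor>makespan I \<sigma> / q\<rfloor>"
  let ?w = "\<lambda>j. nat \<lfloor>start \<sigma> j / q\<rfloor>"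
  define A where "A k = {j \<in> {..<njobs I}. ?w j = k}" for k
  have "?w j < ?N" if "j < njobs I" for j
  proof -
    have "start \<sigma> j / q + 1 \<le> makespan I \<sigma> / q"
      using divide_right_mono[OF start_le_makespan[OF that], of q] pos(4)
      by (simp add: add_divide_distrib)
    moreover have "0 \<le> start \<sigma> j / q" using start_nonneg[OF that] pos(4) by simp
    ultimately show ?thesis by linarith
  qed
  then have "{..<njobs I} = (\<Union>k<?N. A k)" by (auto simp: A_def)
  then have "njobs I = card (\<Union>k<?N. A k)" by (metis card_lessThan)
  also have "\<dots> \<le> (\<Sum>k<?N. card (A k))" by (rule card_UN_le) simp
  also have "\<dots> \<le> (\<Sum>k<?N. alpha (num_sets I) V E)"
  proof (rule sum_mono)
    fix k
    show "card (A k) \<le> alpha (num_sets I) V E"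
    proof (rule card_window[where \<tau> = "real k * q"])
      fix j assume "j \<in> A k"
      then have j: "j < njobs I" "?w j = k" by (auto simp: A_def)
      have "0 \<le> start \<sigma> j / q" using start_nonneg[OF j(1)] pos(4) by simp
      then have "real k \<le> start \<sigma> j / q" "start \<sigma> j / q < real k + 1"
        using j(2) by linarith+
      then show "real k * q \<le> start \<sigma> j \<and> start \<sigma> j < real k * q + q"
        using pos(4) by (simp add: field_simps)
    qed (auto simp: A_def)
  qed
  finally show ?thesis by (simp add: mult.commute)
qed

lemma short_schedule_independent:
  assumes "makespan I \<sigma> < q + block1 I"
  shows "independent_set V E (machine_of \<sigma> ` {..<njobs I})" "card (machine_of \<sigma> ` {..<njobs I}) = njobs I"
proof -
  have less: "start \<sigma> j < block1 I" if "j < njobs I" for j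
    using start_le_makespan[OF that] assms by simp
  have "inj_on (machine_of \<sigma>) {..<njobs I}"
    by (rule inj_on_window[where \<tau> = 0])
      (use less start_nonneg pos in \<open>force simp: system_time_def\<close>)+
  then show "card (machine_of \<sigma> ` {..<njobs I}) = njobs I" by (simp add: card_image)
  have "{machine_of \<sigma> j, machine_of \<sigma> j'} \<notin> E"
    if "j < njobs I" "j' < njobs I" "start \<sigma> j \<le> start \<sigma> j'" for j j'
    using adjacent_machines(1)[OF that(1,2) _ that(3)] less[OF that(2)] start_nonneg[OF that(1)] by force
  then have "{machine_of \<sigma> j, machine_of \<sigma> j'} \<notin> E" if "j < njobs I" "j' < njobs I" for j j'
    using that by (metis insert_commute linear)
  then show "independent_set V E (machine_of \<sigma> ` {..<njobs I})"
    using machine_mem by (auto simp: independent_set_def)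
qed

end

section \<open>Combinatorics of the greedy matching and of the kept sets\<close>

lemma distinct_fst_filter: "distinct (map fst l) \<Longrightarrow> distinct (map fst (filter Q l))"
  by (simp add: distinct_map inj_on_def)

lemma card_fst: "distinct (map fst l) \<Longrightarrow> card (fst ` set l) = length l"
  using distinct_card by fastforce

text \<open>\<open>H\<close> is any set without both ends of a listed edge; it occurs in the
  counting only. No edge survives: once an edge has been processed, one of its ends is missing, and
  later steps only delete.\<close>

lemma greedy_spec:
  assumes "distinct (map fst l)" "\<And>u v. (u, v) \<in> set es \<Longrightarrow> u \<noteq> v \<and> \<not> (u \<in> H \<and> v \<in> H)"
  shows "distinct (map fst (greedy es l))
    \<and> length l \<le> length (greedy es l) + 2 * card (fst ` set l - H)
    \<and> (\<forall>(u, v)\<in>set es. \<not> (u \<in> fst ` set (greedy es l) \<and> v \<in> fst ` set (greedy es l)))"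
  using assms
proof (induction es l rule: greedy.induct)
  case (2 u v es l)
  define l' where "l' = filter (\<lambda>s. fst s \<noteq> u) (filter (\<lambda>s. fst s \<noteq> v) l)"
  define l'' where "l'' = (if length l' + 2 = length l then l' else l)"
  have eq: "greedy ((u, v) # es) l = greedy es l''"
    by (simp add: l''_def l'_def Let_def)
  have d': "distinct (map fst l')" unfolding l'_def by (intro distinct_fst_filter 2(2))
  then have d'': "distinct (map fst l'')" using 2(2) by (simp add: l''_def)
  have set': "fst ` set l' = fst ` set l - {u, v}" by (auto simp: l'_def)
  have uv: "u \<noteq> v" "\<not> (u \<in> H \<and> v \<in> H)" using 2(3) by auto
  have len: "length l' = card (fst ` set l - {u, v})" "length l = card (fst ` set l)"
    using card_fst[OF d'] card_fst[OF 2(2)] set' by simp_all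
  have es: "\<And>u v. (u, v) \<in> set es \<Longrightarrow> u \<noteq> v \<and> \<not> (u \<in> H \<and> v \<in> H)"
    by (rule 2(3)) simp
  from 2(1)[OF l'_def, folded l''_def, OF d'' es]
  have IH: "distinct (map fst (greedy es l''))"
    "length l'' \<le> length (greedy es l'') + 2 * card (fst ` set l'' - H)"
    "\<And>u v. (u, v) \<in> set es \<Longrightarrow> \<not> (u \<in> fst ` set (greedy es l'') \<and> v \<in> fst ` set (greedy es l''))"
    by blast+
  \<comment> \<open>A deleted pair has an end outside \<open>H\<close>, so the part outside
    \<open>H\<close> shrinks by at least one, which pays for the two lost entries.\<close>
  have drop: "length l \<le> length l'' + 2 * (card (fst ` set l - H) - card (fst ` set l'' - H))
     \<and> card (fst ` set l'' - H) \<le> card (fst ` set l - H)"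
  proof (cases "length l' + 2 = length l")
    case True
    have "fst ` set l'' - H \<subset> fst ` set l - H"
    proof -
      have "{u, v} \<subseteq> fst ` set l"
      proof (rule ccontr)
        assume "\<not> {u, v} \<subseteq> fst ` set l"
        then have "fst ` set l - {u, v} = fst ` set l - {u} \<or> fst ` set l - {u, v} = fst ` set l - {v}"
          by auto
        then have "card (fst ` set l) \<le> card (fst ` set l - {u, v}) + 1"
          using diff_card_le_card_Diff[of "{u}" "fst ` set l"]
            diff_card_le_card_Diff[of "{v}" "fst ` set l"] by auto
        then show False using True len by simp
      qed
      then show ?thesis using uv True set' by (auto simp: l''_def)
    qed
    then have "card (fst ` set l'' - H) < card (fst ` set l - H)"
      by (intro psubset_card_mono) auto
    then show ?thesis using True by (simp add: l''_def)
  qed (simp add: l''_def)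
  have size: "length l \<le> length (greedy ((u, v) # es) l) + 2 * card (fst ` set l - H)"
    unfolding eq using IH(2) drop by linarith
  have ind: "\<not> (a \<in> fst ` set (greedy ((u, v) # es) l) \<and> b \<in> fst ` set (greedy ((u, v) # es) l))"
    if ab: "(a, b) \<in> set ((u, v) # es)" for a b
  proof (cases "(a, b) \<in> set es")
    case True
    then show ?thesis unfolding eq by (rule IH(3))
  next
    case False
    then have [simp]: "a = u" "b = v" using ab by auto
    have "\<not> (u \<in> fst ` set l'' \<and> v \<in> fst ` set l'')"
    proof (cases "length l' + 2 = length l")
      case True
      then show ?thesis using set' by (auto simp: l''_def)
    next
      case False
      have "\<not> {u, v} \<subseteq> fst ` set l"
      proof
        assume *: "{u, v} \<subseteq> fst ` set l"
        then have "card (fst ` set l - {u, v}) = card (fst ` set l) - 2"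
          using uv(1) by (simp add: card_Diff_subset)
        moreover have "2 \<le> card (fst ` set l)"
          using card_mono[OF _ *] uv(1) by simp
        ultimately show False using False len by simp
      qed
      then show ?thesis using False by (simp add: l''_def)
    qed
    moreover have "fst ` set (greedy es l'') \<subseteq> fst ` set l''" using greedy_subset by (rule image_mono)
    ultimately show ?thesis unfolding eq by auto
  qed
  have "distinct (map fst (greedy ((u, v) # es) l))" unfolding eq by (rule IH(1))
  with size ind show ?case by blast
qed simp

lemma distinct_concat_disjoint:
  assumes "\<And>i. i < length xss \<Longrightarrow> distinct (xss ! i)"
    and "\<And>i j. i < length xss \<Longrightarrow> j < length xss \<Longrightarrow> i \<noteq> j \<Longrightarrow> set (xss ! i) \<inter> set (xss ! j) = {}"
  shows "distinct (concat xss)"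
  using assms
proof (induction xss)
  case (Cons xs xss)
  have "distinct (concat xss)"
  proof (rule Cons.IH)
    show "distinct (xss ! i)" if "i < length xss" for i
      using Cons.prems(1)[of "Suc i"] that by simp
    show "set (xss ! i) \<inter> set (xss ! j) = {}" if "i < length xss" "j < length xss" "i \<noteq> j" for i j
      using Cons.prems(2)[of "Suc i" "Suc j"] that by simp
  qed
  moreover have "set xs \<inter> set ys = {}" if "ys \<in> set xss" for ys
  proof -
    from that obtain i where "i < length xss" "xss ! i = ys" by (meson in_set_conv_nth)
    then show ?thesis using Cons.prems(2)[of 0 "Suc i"] by simp
  qed
  ultimately show ?case using Cons.prems(1)[of 0] by fastforce
qed simp

lemma distinct_mono_mset:
  assumes "mset ys \<subseteq># mset xs" "distinct xs"
  shows "distinct ys"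
proof -
  from assms(1) obtain R where R: "mset xs = mset ys + R"
    by (auto simp: mset_subset_eq_exists_conv)
  obtain rs where "mset rs = R" using ex_mset by blast
  then have "mset xs = mset (ys @ rs)" using R by simp
  then have "distinct (ys @ rs)" using assms(2) mset_eq_imp_distinct_iff by blast
  then show ?thesis by simp
qed

lemma length_concat_ge:
  "(\<And>ys. ys \<in> set yss \<Longrightarrow> k \<le> length ys) \<Longrightarrow> length yss * k \<le> length (concat yss)"
  by (induction yss) (force simp: add_mono)+

text \<open>The dropped list is at most as long as the average of the \<open>f + 1\<close> kept
  ones.\<close>

lemma kept_large:
  assumes "length xss \<le> f + 2"
  shows "(f + 1) * length (concat xss) \<le> (f + 2) * length (concat (kept f xss))"
proof (cases "f + 1 < length xss")
  case True
  then obtain xs yss where xss: "xss = xs # yss" by (cases xss) auto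
  then have kept: "kept f xss = drop_smallest xs yss" "length yss = f + 1"
    using True assms by (auto simp: kept_def)
  obtain m where m: "mset xss = add_mset m (mset (kept f xss))"
    "\<forall>ys\<in>set (kept f xss). length m \<le> length ys"
    using mset_drop_smallest[of xs yss] kept xss by auto
  have len: "length (concat zss) = sum_mset (image_mset length (mset zss))" for zss :: "nat list list"
    by (induction zss) auto
  have "length (concat xss) = length m + length (concat (kept f xss))"
    by (simp add: len m(1))
  moreover have "(f + 1) * length m \<le> length (concat (kept f xss))"
    using length_concat_ge[of "kept f xss" "length m"] m(2) kept by simp
  ultimately show ?thesis by (simp add: algebra_simps)
qed (simp add: kept_def)

lemma length_kept_le: "length xss \<le> f + 2 \<Longrightarrow> length (kept f xss) \<le> f + 1"
  by (cases xss) (auto simp: kept_def)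

text \<open>\<open>H\<close>, \<open>A - H\<close> and \<open>B - H\<close> are disjoint independent
  sets, and empty sets fill the family up to \<open>c\<close> members.\<close>

lemma exchange_le_alpha:
  assumes "finite V" "3 \<le> c" "independent_set V E H" "independent_set V E A" "independent_set V E B"
    and "A \<inter> B = {}"
  shows "card H + card (A - H) + card (B - H) \<le> alpha c V E"
proof -
  define J where "J i = (if i = 0 then H else if i = 1 then A - H else if i = 2 then B - H else {})"
    for i :: nat
  have fin: "finite H" "finite A" "finite B"
    using assms(1,3-5) finite_subset by (auto simp: independent_set_def)
  have "c_IS V E c J"
    using assms(3-6) by (auto simp: c_IS_def disjoint_family_on_def independent_set_def J_def)
  then have "c_IS_size c J \<le> alpha c V E" using assms(1) by (rule c_IS_size_le_alpha[rotated])
  moreover have "(\<Union>i<c. J i) = H \<union> ((A - H) \<union> (B - H))"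
  proof
    show "(\<Union>i<c. J i) \<subseteq> H \<union> ((A - H) \<union> (B - H))" by (auto simp: J_def split: if_splits)
    have "J 0 \<union> (J 1 \<union> J 2) \<subseteq> (\<Union>i<c. J i)" using assms(2) by (intro Un_least UN_upper) auto
    then show "H \<union> ((A - H) \<union> (B - H)) \<subseteq> (\<Union>i<c. J i)" by (simp add: J_def)
  qed
  moreover have "card (H \<union> ((A - H) \<union> (B - H))) = card H + (card (A - H) + card (B - H))"
    using fin assms(6) by (subst card_Un_disjoint; auto)+
  ultimately show ?thesis by (simp add: c_IS_size_def)
qed

text \<open>Ensures that the given sets are not all empty, so that there are slots to fill.\<close>

lemma alpha_pos:
  assumes "simple_graph V E" "V \<noteq> {}" "c \<ge> 1"
  shows "1 \<le> alpha c V E"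
proof -
  obtain v where v: "v \<in> V" using assms(2) by blast
  define J where "J i = (if i = 0 then {v} else {})" for i :: nat
  have "c_IS V E c J"
    using assms(1) v by (auto simp: c_IS_def independent_set_def disjoint_family_on_def J_def
        simple_graph_def doubleton_eq_iff)
  then have "c_IS_size c J \<le> alpha c V E"
    using assms(1) by (intro c_IS_size_le_alpha) (auto simp: simple_graph_def)
  moreover have "(\<Union>i<c. J i) = {v}" using assms(3) by (auto simp: J_def split: if_splits)
  ultimately show ?thesis by (simp add: c_IS_size_def)
qed

text \<open>\<open>R + 1\<close> is the number of main rounds, \<open>s\<close> and
  \<open>s'\<close> count the given and the kept machines, and \<open>t\<close> is the makespan of a
  compared schedule divided by \<open>q\<close>. With \<open>x = \<gamma> * N\<close> there are two
  opposing bounds, \<open>R < x * (f + 2) / (f + 1)\<close> by counting jobs and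
  \<open>2 * x < R + 1\<close> by \<open>small\<close>. As \<open>R\<close> is an integer and
  \<open>x \<ge> 1\<close>, a single case survives.\<close>

lemma rounds_le:
  fixes R s s' n N f :: nat and \<gamma> t :: real
  assumes "R * s' < n" "real n \<le> \<gamma> * real s * real N" "(f + 1) * s \<le> (f + 2) * s'"
    and "1 \<le> f" "1 \<le> \<gamma>" "1 \<le> N" "real N \<le> t"
    and small: "2 * \<gamma> * t < real R + 1"
  shows "f = 1 \<and> R = 2 \<and> N = 1 \<and> \<gamma> < 3 / 2 \<and> s' \<noteq> s"
proof -
  define x where "x = \<gamma> * real N"
  have x1: "1 \<le> x" using mult_mono[of 1 \<gamma> 1 "real N"] assms(5,6) by (simp add: x_def)
  have xt: "2 * x \<le> 2 * \<gamma> * t" using assms(5,7) by (simp add: x_def mult_left_mono)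
  then have Rx: "2 * x < real R + 1" using small by linarith
  have ns: "real n \<le> x * real s" using assms(2) by (simp add: x_def algebra_simps)
  have s_pos: "0 < s"
  proof (rule ccontr)
    assume "\<not> 0 < s"
    then show False using ns assms(1) by simp
  qed
  have Rs: "real R * real s' < x * real s"
    using ns of_nat_less_iff[of "R * s'" n, where 'a = real] assms(1) by simp
  have ss: "(real f + 1) * real s \<le> (real f + 2) * real s'"
  proof -
    have "real ((f + 1) * s) \<le> real ((f + 2) * s')" using assms(3) by (rule of_nat_mono)
    then show ?thesis by (simp add: algebra_simps)
  qed
  have Rf: "real R * (real f + 1) < x * (real f + 2)"
  proof -
    have "(real R * (real f + 1)) * real s \<le> real R * ((real f + 2) * real s')"
      using mult_left_mono[OF ss, of "real R"] by (simp add: algebra_simps)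
    also have "\<dots> = (real f + 2) * (real R * real s')" by simp
    also have "\<dots> < (real f + 2) * (x * real s)" using Rs by (intro mult_strict_left_mono) auto
    finally have "(real R * (real f + 1)) * real s < (x * (real f + 2)) * real s" by (simp add: algebra_simps)
    then show ?thesis using s_pos by (simp add: mult_less_cancel_right)
  qed
  \<comment> \<open>If nothing is dropped, then \<open>R < x\<close>, hence
    \<open>2 * x < x + 1\<close>, against \<open>x \<ge> 1\<close>.\<close>
  have ne: "s' \<noteq> s"
  proof
    assume "s' = s"
    then have "real R < x" using Rs s_pos by simp
    then show False using Rx x1 by linarith
  qed
  \<comment> \<open>For \<open>f \<ge> 2\<close> the loss factor is at most 4/3. Then
    \<open>2 * x < 4 / 3 * x + 1\<close> gives \<open>x < 3 / 2\<close> and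
    \<open>R \<le> 1\<close>, and finally \<open>x < 1\<close>.\<close>
  have f1: "f = 1"
  proof (rule ccontr)
    assume "f \<noteq> 1"
    then have "2 \<le> f" using assms(4) by simp
    then have f2: "2 \<le> real f" by simp
    have "real R < 4 / 3 * x"
    proof -
      have "x * (real f + 2) \<le> (4 / 3 * x) * (real f + 1)"
        using mult_left_mono[OF f2, of x] x1 by (simp add: algebra_simps)
      then have "real R * (real f + 1) < (4 / 3 * x) * (real f + 1)" using Rf by linarith
      then show ?thesis by (simp add: mult_less_cancel_right)
    qed
    then have "x < 3 / 2" "real R < 2" using Rx by linarith+
    then have "R \<le> 1" by simp
    then show False using Rx x1 by simp
  qed
  \<comment> \<open>For \<open>f = 1\<close> the loss factor is 3/2, so \<open>x < 2\<close> and
    \<open>R \<le> 2\<close>, while \<open>R > 2 * x - 1 \<ge> 1\<close>.\<close>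
  then have Rx2: "real R < 3 / 2 * x" using Rf by simp
  then have "x < 2" using Rx by linarith
  then have "real R < 3" using Rx2 by linarith
  then have "R \<le> 2" by simp
  moreover have "1 < real R" using Rx x1 by linarith
  ultimately have R2: "R = 2" by simp
  then have x32: "x < 3 / 2" using Rx by simp
  moreover have "N = 1"
  proof (rule ccontr)
    assume "N \<noteq> 1"
    then have "2 \<le> real N" using assms(6) by simp
    then have "2 \<le> x" using mult_mono[of 1 \<gamma> 2 "real N"] assms(5) by (simp add: x_def)
    then show False using x32 by simp
  qed
  ultimately show ?thesis using f1 R2 ne by (simp add: x_def)
qed

section \<open>The approximation ratio\<close>

locale plan_input =
  fixes I :: smc_instance and J :: "nat \<Rightarrow> nat set" and \<gamma> :: real
    and xss :: "nat list list" and es :: "(nat \<times> nat) list" and B P B2 D :: nat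
  assumes inst: "smc_id I" and ordered: "ordered_times I" and \<gamma>: "1 \<le> \<gamma>" and D: "0 < D"
    and times: "block1 I = real B / real D" "ptime I = real P / real D" "block2 I = real B2 / real D"
    and edges: "(\<lambda>(u, v). {u, v}) ` set es = conflicts I"
    and length_sets: "length xss \<le> num_sets I"
    and sets: "\<And>i. i < length xss \<Longrightarrow> distinct (xss ! i) \<and> set (xss ! i) = J i"
      "\<And>i. length xss \<le> i \<Longrightarrow> i < num_sets I \<Longrightarrow> J i = {}"
    and approx: "approx_c_IS \<gamma> (machines I) (conflicts I) (num_sets I) J"
begin

abbreviation "f \<equiv> P div B"
abbreviation "q \<equiv> B + (P + B2)"
abbreviation "Q \<equiv> q + f * B"
abbreviation "n \<equiv> njobs I"
abbreviation "sl \<equiv> slots 0 B (kept f xss)"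
abbreviation "xl \<equiv> greedy es (slots 0 0 xss)"
abbreviation "\<alpha> \<equiv> alpha (num_sets I) (machines I) (conflicts I)"

lemma nums: "0 < B" "B2 \<le> B" "B \<le> P" "1 \<le> f" "0 < q"
proof -
  show "0 < B" "B2 \<le> B" "B \<le> P"
    using ordered D by (auto simp: ordered_times_def times field_simps)
  then show "1 \<le> f" "0 < q" by (simp_all add: Suc_le_eq div_greater_zero_iff)
qed

lemma ratio: "ptime I / block1 I = real P / real B"
  using D by (simp add: times)

lemma floor_ratio: "\<lfloor>ptime I / block1 I\<rfloor> = int f"
  unfolding ratio by (simp add: floor_divide_of_nat_eq)

lemma num_sets_le: "num_sets I \<le> f + 2"
proof -
  have "\<lceil>ptime I / block1 I\<rceil> \<le> int f + 1" using floor_ratio by linarith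
  then show ?thesis by (simp add: num_sets_def nat_le_iff)
qed

lemma system_time_eq: "system_time I = real q / real D"
  by (simp add: system_time_def times add_divide_distrib)

lemma system_time_less:
  assumes "f = 1"
  shows "system_time I < 4 * block1 I"
proof -
  have "P < 2 * B"
    using assms nums(1) by (metis div_less_iff_less_mult one_less_numeral_iff semiring_norm(76))
  then have "q < 4 * B" using nums(2) by linarith
  then have "real q < real (4 * B)" by (simp only: of_nat_less_iff)
  then have "real q / real D < real (4 * B) / real D" using D by (intro divide_strict_right_mono) auto
  then show ?thesis unfolding system_time_eq times by simp
qed

lemma c_IS: "c_IS (machines I) (conflicts I) (num_sets I) J"
  using approx by (simp add: approx_c_IS_def)

lemma independent: "ys \<in> set xss \<Longrightarrow> independent_set (machines I) (conflicts I) (set ys)"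
  using c_IS sets(1) length_sets by (auto simp: c_IS_def in_set_conv_nth)

lemma disjoint_sets: "i < length xss \<Longrightarrow> j < length xss \<Longrightarrow> i \<noteq> j \<Longrightarrow> set (xss ! i) \<inter> set (xss ! j) = {}"
  using c_IS sets(1) length_sets by (auto simp: c_IS_def disjoint_family_on_def)

lemma distinct_sets: "distinct (concat xss)"
  using sets(1) disjoint_sets by (intro distinct_concat_disjoint) auto

lemma graph: "simple_graph (machines I) (conflicts I)" "machines I \<noteq> {}" "1 \<le> n" "finite (machines I)"
  using inst by (auto simp: smc_id_def simple_graph_def)

lemma edge_distinct: "(u, v) \<in> set es \<Longrightarrow> {u, v} \<in> conflicts I \<and> u \<noteq> v"
proof -
  assume "(u, v) \<in> set es"
  then have "{u, v} \<in> conflicts I" using edges by force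
  then show ?thesis using graph(1) by (auto simp: simple_graph_def doubleton_eq_iff)
qed

lemma alpha_le: "real \<alpha> \<le> \<gamma> * real (length (concat xss))"
proof -
  have "(\<Union>i<num_sets I. J i) = set (concat xss)"
  proof
    show "(\<Union>i<num_sets I. J i) \<subseteq> set (concat xss)"
    proof
      fix u assume "u \<in> (\<Union>i<num_sets I. J i)"
      then obtain i where i: "i < num_sets I" "u \<in> J i" by blast
      then have "i < length xss" using sets(2)[of i] by fastforce
      then show "u \<in> set (concat xss)" using sets(1)[of i] i nth_mem by fastforce
    qed
    show "set (concat xss) \<subseteq> (\<Union>i<num_sets I. J i)"
      using sets(1) length_sets by (fastforce simp: in_set_conv_nth)
  qed
  then have "c_IS_size (num_sets I) J = length (concat xss)"
    using distinct_card[OF distinct_sets] by (simp add: c_IS_size_def)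
  then show ?thesis using approx \<gamma> by (simp add: approx_c_IS_def field_simps)
qed

lemma length_xss: "length xss \<le> f + 2"
  using length_sets num_sets_le by linarith

lemma sl_nonempty: "sl \<noteq> []"
proof -
  have "1 \<le> \<alpha>" using alpha_pos[OF graph(1,2)] by (simp add: num_sets_def)
  then have "length (concat xss) \<noteq> 0" using alpha_le by (intro notI) simp
  then have "length (concat (kept f xss)) \<noteq> 0"
    using kept_large[OF length_xss] by (intro notI) simp
  then show ?thesis using length_slots[of 0 B "kept f xss"] by (metis list.size(3))
qed

text \<open>Adjacent machines belong to different kept sets, so their offsets differ by a positive
  multiple of \<open>B\<close> that is at most \<open>f * B \<le> P\<close>.\<close>

lemma slot_plan_main: "slot_plan I sl B P B2 D Q"
proof
  show "distinct (map fst sl)"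
    using distinct_mono_mset[OF mset_concat_kept distinct_sets] by simp
  have slot: "\<exists>ys\<in>set xss. \<exists>i\<le>f. m \<in> set ys \<and> a = i * B \<and> kept f xss ! i = ys"
    if sl: "(m, a) \<in> set sl" for m a
  proof -
    obtain i where i: "i < length (kept f xss)" "m \<in> set (kept f xss ! i)" "a = 0 + i * B"
      using slots_mem[OF sl] by blast
    have "i \<le> f" using i(1) length_kept_le[OF length_xss] by simp
    then show ?thesis using i set_kept[of f xss] nth_mem[OF i(1)] by (metis add_0 subsetD)
  qed
  show "m \<in> machines I \<and> a + (B + P + B2) \<le> Q" if m: "(m, a) \<in> set sl" for m a
  proof -
    obtain ys i where ys: "ys \<in> set xss" "i \<le> f" "m \<in> set ys" "a = i * B" using slot[OF m] by blast
    have "a \<le> f * B" unfolding ys(4) by (rule mult_le_mono1[OF ys(2)])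
    then show ?thesis using independent[OF ys(1)] ys(3) by (auto simp: independent_set_def)
  qed
  show "a + B \<le> a' \<and> a' \<le> a + P"
    if m: "(m, a) \<in> set sl" "(m', a') \<in> set sl" "{m, m'} \<in> conflicts I" "a \<le> a'" for m a m' a'
  proof -
    obtain ys i where ys: "ys \<in> set xss" "i \<le> f" "m \<in> set ys" "a = i * B" "kept f xss ! i = ys"
      using slot[OF m(1)] by blast
    obtain ys' i' where ys': "ys' \<in> set xss" "i' \<le> f" "m' \<in> set ys'" "a' = i' * B" "kept f xss ! i' = ys'"
      using slot[OF m(2)] by blast
    have "i \<noteq> i'"
      using m(3) independent[OF ys(1)] ys ys' by (auto simp: independent_set_def)
    moreover have "i \<le> i'" using m(4) ys(4) ys'(4) nums(1) by simp
    ultimately have "Suc i * B \<le> i' * B" by (intro mult_le_mono1) simp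
    moreover have "i' * B \<le> f * B" by (rule mult_le_mono1[OF ys'(2)])
    moreover have "f * B \<le> P" by (rule div_times_less_eq_dividend)
    ultimately show ?thesis unfolding ys(4) ys'(4) mult_Suc by linarith
  qed
qed (use D sl_nonempty times nums in auto)

lemma greedy_facts:
  assumes "\<And>u v. (u, v) \<in> set es \<Longrightarrow> \<not> (u \<in> H \<and> v \<in> H)"
  shows "distinct (map fst xl)"
    and "length (concat xss) \<le> length xl + 2 * card (set (concat xss) - H)"
    and "\<And>u v. (u, v) \<in> set es \<Longrightarrow> \<not> (u \<in> fst ` set xl \<and> v \<in> fst ` set xl)"
proof -
  have d: "distinct (map fst (slots 0 0 xss))" using distinct_sets by simp
  have "fst ` set (slots 0 0 xss) = set (concat xss)"
    by (metis list.set_map map_fst_slots)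
  moreover have "\<And>u v. (u, v) \<in> set es \<Longrightarrow> u \<noteq> v \<and> \<not> (u \<in> H \<and> v \<in> H)"
    using assms edge_distinct by blast
  from greedy_spec[OF d this]
  have "distinct (map fst xl)"
    "length (slots 0 0 xss) \<le> length xl + 2 * card (fst ` set (slots 0 0 xss) - H)"
    "\<forall>(u, v)\<in>set es. \<not> (u \<in> fst ` set xl \<and> v \<in> fst ` set xl)"
    by blast+
  ultimately show "distinct (map fst xl)"
    "length (concat xss) \<le> length xl + 2 * card (set (concat xss) - H)"
    "\<And>u v. (u, v) \<in> set es \<Longrightarrow> \<not> (u \<in> fst ` set xl \<and> v \<in> fst ` set xl)"
    by auto
qed

lemma slot_plan_fallback:
  assumes "xl \<noteq> []"
  shows "slot_plan I xl B P B2 D q"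
proof
  \<comment> \<open>The size bound is irrelevant for feasibility, so \<open>H\<close> can be
    empty.\<close>
  note g = greedy_facts[of "{}", simplified]
  show "distinct (map fst xl)" by (rule g)
  have slot: "m \<in> machines I \<and> a = 0" if "(m, a) \<in> set xl" for m a
  proof -
    have "(m, a) \<in> set (slots 0 0 xss)" using that greedy_subset by blast
    then obtain i where "i < length xss" "m \<in> set (xss ! i)" "a = 0"
      using slots_mem by fastforce
    then show ?thesis using independent nth_mem by (force simp: independent_set_def)
  qed
  then show "m \<in> machines I \<and> a + (B + P + B2) \<le> q" if "(m, a) \<in> set xl" for m a
    using that by force
  show "a + B \<le> a' \<and> a' \<le> a + P"
    if m: "(m, a) \<in> set xl" "(m', a') \<in> set xl" "{m, m'} \<in> conflicts I" for m a m' a'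
  proof -
    have in_fst: "m \<in> fst ` set xl" "m' \<in> fst ` set xl" using m by force+
    from m(3) obtain e where "e \<in> set es" "{m, m'} = (\<lambda>(u, v). {u, v}) e"
      unfolding edges[symmetric] by (elim imageE)
    moreover obtain u v where "e = (u, v)" by (cases e)
    ultimately have "(u, v) \<in> set es" "{m, m'} = {u, v}" by simp_all
    then show ?thesis using g(3)[of u v] in_fst by (auto simp: doubleton_eq_iff)
  qed
qed (use D assms times nums in auto)

text \<open>Let T be the union of the three sets, \<open>s\<close> its size and \<open>u\<close> the
  size of T - \<open>H\<close>. Adding the exchange bounds for the three pairs gives
  \<open>3 * n + 2 * u \<le> 3 * \<alpha>\<close>, and \<open>\<alpha> \<le> 3 / 2 * s\<close> by
  the bound on \<gamma>. Moreover \<open>many\<close> and the size of the kept sets give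
  \<open>s < 3 / 4 * n\<close>. So at least
  \<open>s - 2 * u \<ge> 3 * n - 7 / 2 * s > 3 / 8 * n\<close> vertices survive the
  matching.\<close>

lemma fallback_large:
  assumes \<sigma>: "conflict_free I \<sigma>" and short: "makespan I \<sigma> < system_time I + block1 I"
    and f1: "f = 1" and dropped: "length (concat (kept f xss)) \<noteq> length (concat xss)"
    and many: "2 * length (concat (kept f xss)) < n" and \<gamma>': "\<gamma> < 3 / 2"
  shows "n \<le> 3 * length xl"
proof -
  interpret S: feasible_schedule I \<sigma> by unfold_locales (rule inst ordered \<sigma>)+
  define H where "H = machine_of \<sigma> ` {..<n}"
  note H = S.short_schedule_independent[OF short, folded H_def]
  have "length xss = 3"
  proof -
    have "f + 1 < length xss" using dropped by (auto simp: kept_def split: if_splits)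
    then show ?thesis using f1 length_xss by simp
  qed
  then obtain X Y Z where xss: "xss = [X, Y, Z]"
    by (auto simp: numeral_3_eq_3 length_Suc_conv)
  have c3: "3 \<le> num_sets I" using length_sets \<open>length xss = 3\<close> by simp
  have ind: "independent_set (machines I) (conflicts I) (set X)"
    "independent_set (machines I) (conflicts I) (set Y)"
    "independent_set (machines I) (conflicts I) (set Z)"
    using independent xss by auto
  have disj: "set X \<inter> set Y = {}" "set X \<inter> set Z = {}" "set Y \<inter> set Z = {}"
    using distinct_sets xss by auto
  define u where "u = card (set (concat xss) - H)"
  have "set (concat xss) - H = (set X - H) \<union> ((set Y - H) \<union> (set Z - H))" using xss by auto
  then have "u \<le> card (set X - H) + (card (set Y - H) + card (set Z - H))"
    unfolding u_def by (metis card_Un_le add_left_mono le_trans)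
  moreover note ex = exchange_le_alpha[OF graph(4) c3 H(1)]
  have "n + card (set X - H) + card (set Y - H) \<le> \<alpha>" "n + card (set X - H) + card (set Z - H) \<le> \<alpha>"
    "n + card (set Y - H) + card (set Z - H) \<le> \<alpha>"
    using ex[OF ind(1,2) disj(1)] ex[OF ind(1,3) disj(2)] ex[OF ind(2,3) disj(3)] H(2) by simp_all
  ultimately have "3 * n + 2 * u \<le> 3 * \<alpha>" by linarith
  then have "3 * real n + 2 * real u \<le> 3 * real \<alpha>" by linarith
  moreover have "real \<alpha> \<le> 3 / 2 * real (length (concat xss))"
    using alpha_le mult_right_mono[of \<gamma> "3 / 2" "real (length (concat xss))"] \<gamma>' by linarith
  moreover have "length (concat xss) \<le> length xl + 2 * u"
    unfolding u_def
  proof (rule greedy_facts(2))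
    show "\<not> (a \<in> H \<and> b \<in> H)" if "(a, b) \<in> set es" for a b
      using edge_distinct[OF that] H(1) by (auto simp: independent_set_def)
  qed
  moreover have "2 * length (concat xss) \<le> 3 * length (concat (kept f xss))"
    using kept_large[OF length_xss] f1 by simp
  ultimately show ?thesis using many by linarith
qed

text \<open>\<open>small\<close> says that the \<open>R + 1\<close> main rounds exceed the allowed
  makespan, measured in round lengths. The conclusion collects what makes the fallback selectable
  and short enough in that event.\<close>

lemma bound_main:
  fixes \<sigma> :: schedule
  assumes \<sigma>: "conflict_free I \<sigma>"
  defines "t \<equiv> makespan I \<sigma> / system_time I" and "R \<equiv> (n - 1) div length sl"
  assumes small: "2 * \<gamma> * t < real R + 1"
  shows "1 \<le> t \<and> 4 / 3 < \<gamma> \<and> R = 2 \<and> f = 1 \<and> 2 * length sl < n \<and> n \<le> 3 * length xl"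
proof -
  interpret S: feasible_schedule I \<sigma> by unfold_locales (rule inst ordered \<sigma>)+
  define s where "s = length (concat xss)"
  define s' where "s' = length (concat (kept f xss))"
  define N where "N = nat \<lfloor>t\<rfloor>"
  have sl: "length sl = s'" by (simp add: s'_def)
  have n_le: "n \<le> \<alpha> * N" using S.njobs_le by (simp add: N_def t_def)
  have N1: "1 \<le> N" using n_le graph(3) by (cases N) auto
  then have Nt: "real N \<le> t" unfolding N_def by linarith
  have nR: "real n \<le> \<gamma> * real s * real N"
  proof -
    have "real n \<le> real \<alpha> * real N" using n_le by (metis of_nat_le_iff of_nat_mult)
    also have "\<dots> \<le> \<gamma> * real s * real N" using alpha_le by (intro mult_right_mono) (auto simp: s_def)
    finally show ?thesis .
  qed
  have Rn: "R * s' < n"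
  proof -
    have "R * s' \<le> n - 1" unfolding R_def sl by (rule div_times_less_eq_dividend)
    then show ?thesis using graph(3) by simp
  qed
  have ss: "(f + 1) * s \<le> (f + 2) * s'" unfolding s_def s'_def by (rule kept_large[OF length_xss])
  from rounds_le[OF Rn nR ss nums(4) \<gamma> N1 Nt small]
  have *: "f = 1" "R = 2" "N = 1" "\<gamma> < 3 / 2" "s' \<noteq> s" by auto
  have many: "2 * s' < n" using Rn *(2) by simp
  \<comment> \<open>From \<open>2 * s \<le> 3 * s'\<close> and \<open>2 * s' < n\<close>. Together
    with \<open>n \<le> \<gamma> * s\<close>, valid because \<open>N = 1\<close>, this forces
    \<gamma> above 4/3.\<close>
  have "4 * s < 3 * n" using ss many *(1) by simp
  then have "4 * real s < 3 * real n" by linarith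
  then have "4 * real s < 3 * \<gamma> * real s" using nR *(3) by simp
  then have "(4 - 3 * \<gamma>) * real s < 0" by (simp add: algebra_simps)
  then have \<gamma>43: "4 / 3 < \<gamma>" by (simp add: mult_less_0_iff)
  \<comment> \<open>9/8 is what \<open>2 * \<gamma> * t < 3\<close> leaves for \<open>t\<close> when
    \<gamma> exceeds 4/3.\<close>
  have t98: "t < 9 / 8"
  proof (rule ccontr)
    assume "\<not> t < 9 / 8"
    then have "(4 / 3) * (9 / 8) \<le> \<gamma> * t" using \<gamma>43 by (intro mult_mono) auto
    then show False using small *(2) by simp
  qed
  \<comment> \<open>The excess over \<open>q\<close> is below \<open>q / 8\<close>, and
    \<open>q < 4 * b\<close>.\<close>
  have "makespan I \<sigma> < system_time I + block1 I"
  proof -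
    note system_time_less[OF *(1)]
    moreover have "makespan I \<sigma> < 9 / 8 * system_time I"
      using t98 S.pos(4) by (simp add: t_def field_simps)
    ultimately show ?thesis using S.pos by simp
  qed
  then have "n \<le> 3 * length xl"
    using fallback_large[OF \<sigma>] * many by (simp add: s_def s'_def)
  then show ?thesis using * Nt \<gamma>43 many sl by simp
qed

text \<open>\<open>U\<close> is the length of a main round, and the claimed bound equals
  \<open>2 * \<gamma> * t * U\<close>. For the main plan it remains to compare the number of rounds
  with \<open>2 * \<gamma> * t\<close>.\<close>

lemma makespan_bound:
  assumes \<sigma>: "conflict_free I \<sigma>" and plan: "plan n es xss B P q = (l, T)"
  shows "makespan I (job_schedule l T D) \<le>
    2 * \<gamma> * (1 + of_int \<lfloor>ptime I / block1 I\<rfloor> * (block1 I / system_time I)) * makespan I \<sigma>"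
proof -
  interpret S: feasible_schedule I \<sigma> by unfold_locales (rule inst ordered \<sigma>)+
  define t where "t = makespan I \<sigma> / system_time I"
  define R where "R = (n - 1) div length sl"
  define U where "U = system_time I + real f * block1 I"
  have U: "real Q / real D = U"
    by (simp add: U_def system_time_def times add_divide_distrib)
  have U_pos: "0 < U" "system_time I \<le> U" using S.pos by (simp_all add: U_def add_pos_nonneg)
  have goal: "2 * \<gamma> * (1 + of_int \<lfloor>ptime I / block1 I\<rfloor> * (block1 I / system_time I)) * makespan I \<sigma> =
    2 * \<gamma> * t * U"
    using S.pos(4) by (simp add: floor_ratio t_def U_def field_simps)
  consider "2 * length sl < n" "n \<le> 3 * length xl" "l = xl" "T = q"
    | "\<not> (2 * length sl < n \<and> n \<le> 3 * length xl)" "l = sl" "T = Q"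
    using plan by (auto simp: plan_def choose_slots_def split: if_splits)
  then show ?thesis
  proof cases
    case 1
    have ne: "xl \<noteq> []" using 1 graph(3) by auto
    interpret R: slot_plan I xl B P B2 D q by (rule slot_plan_fallback[OF ne])
    have "(n - 1) div length xl < 3" using 1 graph(3) ne by (simp add: div_less_iff_less_mult)
    then have "real (Suc ((n - 1) div length xl)) \<le> 3" by simp
    then have "real (Suc ((n - 1) div length xl)) * real q / real D \<le> 3 * system_time I"
      unfolding system_time_eq times_divide_eq_right[symmetric] by (intro mult_right_mono) auto
    then have ms: "makespan I (job_schedule l T D) \<le> 3 * system_time I"
      using R.makespan_job_schedule[OF graph(3)] 1 by simp
    show ?thesis
    proof (cases "2 * \<gamma> * t < real R + 1")
      case True
      from bound_main[OF \<sigma>, folded t_def R_def, OF True]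
      have *: "1 \<le> t" "4 / 3 < \<gamma>" "f = 1" by auto
      \<comment> \<open>For \<open>f = 1\<close> a main round has length \<open>q + b\<close>, and
        \<open>b > q / 4\<close>.\<close>
      have U5: "5 / 4 * system_time I \<le> U"
        using system_time_less[OF *(3)] *(3) by (simp add: U_def)
      have "4 / 3 * 1 \<le> \<gamma> * t" using * by (intro mult_mono) auto
      then have "8 / 3 * (5 / 4 * system_time I) \<le> 2 * \<gamma> * t * U"
        using U5 S.pos(4) by (intro mult_mono) auto
      then show ?thesis using ms S.pos(4) unfolding goal by linarith
    next
      case False
      \<comment> \<open>Here the main plan meets the ratio although it needs at least three rounds;
        three rounds of length \<open>q\<close> are no longer than that.\<close>
      have "0 < length sl" by (rule length_greater_0_conv[THEN iffD2, OF sl_nonempty])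
      moreover have "2 * length sl \<le> n - 1" using 1(1) by linarith
      ultimately have "2 \<le> R"
        unfolding R_def by (rule iffD2[OF less_eq_div_iff_mult_less_eq])
      then have "3 \<le> 2 * \<gamma> * t" using False by simp
      then have "3 * system_time I \<le> 2 * \<gamma> * t * U" using U_pos S.pos(4) by (intro mult_mono) auto
      then show ?thesis using ms unfolding goal by linarith
    qed
  next
    case 2
    interpret R: slot_plan I sl B P B2 D Q by (rule slot_plan_main)
    have ms: "makespan I (job_schedule l T D) \<le> real (Suc R) * U"
      using R.makespan_job_schedule[OF graph(3)] 2 by (simp add: R_def U[symmetric] del: of_nat_Suc of_nat_add)
    have "real R + 1 \<le> 2 * \<gamma> * t"
      using bound_main[OF \<sigma>] 2(1) unfolding t_def R_def by linarith
    then have "real (Suc R) * U \<le> 2 * \<gamma> * t * U" using U_pos by (intro mult_right_mono) auto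
    then show ?thesis using ms unfolding goal by linarith
  qed
qed

lemma plan_correct:
  assumes plan: "plan n es xss B P q = (l, T)"
  shows "conflict_free I (job_schedule l T D)"
    and "makespan I (job_schedule l T D) \<le>
      2 * \<gamma> * (1 + of_int \<lfloor>ptime I / block1 I\<rfloor> * (block1 I / system_time I)) * opt_makespan I"
proof -
  define \<rho> where "\<rho> = 2 * \<gamma> * (1 + of_int \<lfloor>ptime I / block1 I\<rfloor> * (block1 I / system_time I))"
  have \<rho>: "0 < \<rho>"
    using \<gamma> nums by (auto simp: \<rho>_def floor_ratio times system_time_eq intro!: mult_pos_pos add_pos_nonneg)
  show cf: "conflict_free I (job_schedule l T D)"
  proof (cases "l = sl \<and> T = Q")
    case True
    then show ?thesis using slot_plan.conflict_free_job_schedule[OF slot_plan_main] by simp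
  next
    case False
    then have "l = xl" "T = q" "n \<le> 3 * length xl"
      using plan by (auto simp: plan_def choose_slots_def split: if_splits)
    moreover have "xl \<noteq> []" using \<open>n \<le> 3 * length xl\<close> graph(3) by (intro notI) simp
    ultimately show ?thesis
      using slot_plan.conflict_free_job_schedule[OF slot_plan_fallback] by simp
  qed
  \<comment> \<open>\<open>makespan_bound\<close> compares with every feasible schedule, so it
    passes to the infimum; the plan itself shows that the infimum is over a nonempty set.\<close>
  have "makespan I (job_schedule l T D) / \<rho> \<le> opt_makespan I"
    unfolding opt_makespan_def
  proof (rule cInf_greatest)
    show "{makespan I \<sigma> |\<sigma>. conflict_free I \<sigma>} \<noteq> {}" using cf by blast
  next
    fix y assume "y \<in> {makespan I \<sigma> |\<sigma>. conflict_free I \<sigma>}"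
    then obtain \<sigma> where "conflict_free I \<sigma>" "y = makespan I \<sigma>" by blast
    then show "makespan I (job_schedule l T D) / \<rho> \<le> y"
      using makespan_bound[OF _ plan, folded \<rho>_def] \<rho> by (simp add: pos_divide_le_eq mult.commute)
  qed
  then show "makespan I (job_schedule l T D) \<le>
      2 * \<gamma> * (1 + of_int \<lfloor>ptime I / block1 I\<rfloor> * (block1 I / system_time I)) * opt_makespan I"
    using \<rho> unfolding \<rho>_def[symmetric] by (simp add: pos_divide_le_eq mult.commute)
qed

end

section \<open>Decoding the input and assembling the result\<close>

lemma represents_setE:
  assumes "represents_set x A"
  obtains xs where "distinct xs" "set xs = A" "x = vnats xs"
  using assms unfolding represents_set_def vnats_def by blast

lemma represents_c_ISE:
  assumes "represents_c_IS x c J"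
  obtains xss where "length xss \<le> c" "x = vsets xss"
    and "\<And>i. i < length xss \<Longrightarrow> distinct (xss ! i) \<and> set (xss ! i) = J i"
    and "\<And>i. length xss \<le> i \<Longrightarrow> i < c \<Longrightarrow> J i = {}"
proof -
  from assms obtain xs where xs: "length xs \<le> c" "x = vlist xs"
    "\<forall>i<length xs. represents_set (xs ! i) (J i)" "\<forall>i. length xs \<le> i \<and> i < c \<longrightarrow> J i = {}"
    unfolding represents_c_IS_def by blast
  have "\<forall>i. \<exists>ms. i < length xs \<longrightarrow> distinct ms \<and> set ms = J i \<and> xs ! i = vnats ms"
    using xs(3) by (meson represents_setE)
  then obtain g where g: "\<And>i. i < length xs \<Longrightarrow> distinct (g i) \<and> set (g i) = J i \<and> xs ! i = vnats (g i)"
    by metis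
  have "xs = map vnats (map g [0..<length xs])"
    using g by (intro nth_equalityI) simp_all
  then have "x = vsets (map g [0..<length xs])" using xs(2) by simp
  then show thesis
    using that[of "map g [0..<length xs]"] xs(1,4) g by simp
qed

lemma represents_realE:
  assumes "represents_real x r"
  obtains a d where "0 < d" "x = vfrac a d" "r = real a / real d"
  using assms unfolding represents_real_def vfrac_def by blast

lemma represents_edgesE:
  assumes "represents_edges x E"
  obtains es where "(\<lambda>(u, v). {u, v}) ` set es = E" "x = vpairs es"
  using assms unfolding represents_edges_def vpairs_def by blast

lemma approximation_algorithm_prog:
  assumes "1 \<le> \<gamma>"
  shows "approximation_algorithm prog (input_with_c_IS \<gamma>)
    (\<lambda>I. 2 * \<gamma> * (1 + of_int \<lfloor>ptime I / block1 I\<rfloor> * (block1 I / system_time I)))"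
  unfolding approximation_algorithm_def
\<comment> \<open>One number has to serve as factor and as exponent. The factor of the time bound is
  taken, and the exponent 4 is raised to it by \<open>vsize x \<ge> 1\<close>.\<close>
proof (rule exI[of _ 1000000], intro allI impI)
  fix x I assume input: "input_with_c_IS \<gamma> x I"
  obtain xI xJ J where x: "smc_id I" "ordered_times I" "x = VCons xI xJ" "represents_instance xI I"
    "represents_c_IS xJ (num_sets I) J"
    "approx_c_IS \<gamma> (machines I) (conflicts I) (num_sets I) J"
    using input unfolding input_with_c_IS_def by blast
  obtain xV xE x1 xp x2 where xI: "represents_edges xE (conflicts I)"
    "represents_real x1 (block1 I)" "represents_real xp (ptime I)" "represents_real x2 (block2 I)"
    "xI = vlist [xV, xE, vlist (replicate (njobs I) VNil), x1, xp, x2]"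
    using x(4) unfolding represents_instance_def by blast
  obtain es where es: "(\<lambda>(u, v). {u, v}) ` set es = conflicts I" "xE = vpairs es"
    using xI(1) by (rule represents_edgesE)
  obtain a1 d1 where n1: "0 < d1" "x1 = vfrac a1 d1" "block1 I = real a1 / real d1"
    using xI(2) by (rule represents_realE)
  obtain ap dp where np: "0 < dp" "xp = vfrac ap dp" "ptime I = real ap / real dp"
    using xI(3) by (rule represents_realE)
  obtain a2 d2 where n2: "0 < d2" "x2 = vfrac a2 d2" "block2 I = real a2 / real d2"
    using xI(4) by (rule represents_realE)
  obtain xss where xss: "length xss \<le> num_sets I" "xJ = vsets xss"
    "\<And>i. i < length xss \<Longrightarrow> distinct (xss ! i) \<and> set (xss ! i) = J i"
    "\<And>i. length xss \<le> i \<Longrightarrow> i < num_sets I \<Longrightarrow> J i = {}"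
    using x(5) by (rule represents_c_ISE) blast
  define D where "D = d1 * (dp * d2)"
  define B where "B = a1 * (dp * d2)"
  define P where "P = ap * (d1 * d2)"
  define B2 where "B2 = a2 * (d1 * dp)"
  interpret plan_input I J \<gamma> xss es B P B2 D
  proof
    show "block1 I = real B / real D" "ptime I = real P / real D" "block2 I = real B2 / real D"
      using n1 np n2 by (simp_all add: B_def P_def B2_def D_def)
  qed (use assms x es xss n1 np n2 in \<open>auto simp: D_def\<close>)
  obtain l T where plan: "plan (njobs I) es xss B P (B + (P + B2)) = (l, T)" by fastforce
  have "x = VCons (vlist [xV, vpairs es, vlist (replicate (njobs I) VNil),
      vfrac a1 d1, vfrac ap dp, vfrac a2 d2]) (vsets xss)"
    using x(3) xI(5) es n1 np n2 xss(2) by simp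
  from runs_prog[OF this sl_nonempty[unfolded B_def P_def] plan[unfolded B_def P_def B2_def]]
  obtain t where t: "runs prog x (vjobs l T D 0 (njobs I)) t" "t \<le> 1000000 * vsize x ^ 4"
    unfolding D_def by blast
  have "vsize x ^ 4 \<le> vsize x ^ 1000000"
    using vsize_pos by (intro power_increasing) simp_all
  then have "t \<le> 1000000 * vsize x ^ 1000000" using t(2) by linarith
  moreover have "represents_schedule (vjobs l T D 0 (njobs I)) I (job_schedule l T D)"
    by (rule represents_job_schedule[OF D])
  ultimately show "\<exists>y t \<sigma>. runs prog x y t \<and> t \<le> 1000000 * vsize x ^ 1000000 \<and>
      represents_schedule y I \<sigma> \<and> conflict_free I \<sigma> \<and> makespan I \<sigma> \<le>
      2 * \<gamma> * (1 + of_int \<lfloor>ptime I / block1 I\<rfloor> * (block1 I / system_time I)) * opt_makespan I"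
    using t(1) plan_correct[OF plan] by blast
qed

lemma ratio_less:
  assumes "1 \<le> \<gamma>" "ordered_times I"
  shows "2 * \<gamma> * (1 + of_int \<lfloor>ptime I / block1 I\<rfloor> * (block1 I / system_time I)) < 4 * \<gamma>"
proof -
  have pos: "0 < block1 I" "0 < system_time I" "ptime I < system_time I"
    using assms(2) by (auto simp: ordered_times_def system_time_def)
  have "of_int \<lfloor>ptime I / block1 I\<rfloor> * block1 I \<le> ptime I / block1 I * block1 I"
    using pos by (intro mult_right_mono) auto
  also have "\<dots> < system_time I" using pos by simp
  finally have "of_int \<lfloor>ptime I / block1 I\<rfloor> * (block1 I / system_time I) < 1"
    using pos by (simp add: field_simps)
  then show ?thesis using assms(1) by simp
qed

theorem theorem3p7:
  fixes \<gamma> :: real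
  assumes "\<gamma> \<ge> 1"
  shows "allows_approximation (input_with_c_IS \<gamma>)
           (\<lambda>I. 2 * \<gamma> * (1 + of_int \<lfloor>ptime I / block1 I\<rfloor> * (block1 I / system_time I)))
       \<and> (\<forall>I. smc_id I \<and> ordered_times I \<longrightarrow>
           2 * \<gamma> * (1 + of_int \<lfloor>ptime I / block1 I\<rfloor> * (block1 I / system_time I)) < 4 * \<gamma>)"
  using approximation_algorithm_prog[OF assms] ratio_less[OF assms]
  unfolding allows_approximation_def by blast

end
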